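(* Let $\Gamma,\Delta$ be countable groups, let $b_0$ be a measure preserving action of $\Gamma$ on a standard probability space $(X,\mu)$ with orbit equivalence relation $F=E^X_\Gamma$, and let $a_0$ be a free measure preserving action of $\Delta$ on $(X,\mu)$ with orbit equivalence relation $E=E^X_\Delta\subseteq F$, such that there is a fixed number $N\in\{1,2,\dots,\aleph_0\}$ of $E$-classes in each $F$-class. Suppose that $b_0$ is free and mixing and $a_0$ is ergodic. Then for every measure preserving action $a$ of $\Delta$ on a standard probability space $(Y,\nu)$: if $a$ is mixing, then the co-induced action $b=\mathrm{CInd}(a_0,b_0)^\Gamma_\Delta(a)$ is mixing.
   Context: Standard probability space: isomorphic to $[0,1]$ with Lebesgue measure; everything is modulo null sets. A measure preserving action of a countable group $\Lambda$ on $(Z,\rho)$ is mixing if $\rho(\lambda\cdot A\cap B)\to\rho(A)\rho(B)$ as $\lambda\to\infty$ for all Borel $A,B\subseteq Z$. Co-induced action. Identify $N$ with $\{0,\dots,N-1\}$ if finite and with $\mathbb N$ if $N=\aleph_0$. Fix Borel choice functions $C_n:X\to X$ ($n\in N$) with $C_0=\mathrm{id}$ such that for each $x$ the points $C_n(x)$, $n\in N$, are distinct and form a transversal for the $E$-classes contained in $[x]_F$; since $a_0$ is ergodic, the $C_n$ can be, and are, chosen to be one-to-one. For $\gamma\in\Gamma$, $x\in X$ let $\pi(\gamma,x)$ be the permutation of $N$ defined by $\pi(\gamma,x)(k)=n\Leftrightarrow [C_k(x)]_E=[C_n(\gamma\cdot x)]_E$, and for $n\in N$ let $\bar\delta(\gamma,x)_n$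 be the unique element of $\Delta$ with $\bar\delta(\gamma,x)_n\cdot C_{\pi(\gamma,x)^{-1}(n)}(x)=C_n(\gamma\cdot x)$ (action $a_0$). Given a measure preserving action $a$ of $\Delta$ on $(Y,\nu)$, $\mathrm{CInd}(a_0,b_0)^\Gamma_\Delta(a)$ is the measure preserving action of $\Gamma$ on $(X\times Y^N,\mu\times\nu^N)$ given by $\gamma\cdot(x,\bar y)=(\gamma\cdot x,\ (n\mapsto \bar\delta(\gamma,x)_n\cdot \bar y_{\pi(\gamma,x)^{-1}(n)}))$, where $\Delta$ acts on $Y$ by $a$. Up to isomorphism it does not depend on the choice functions. *)

theory Defs
  imports
    "HOL-Analysis.Analysis"
    "HOL-Library.Equipollence"
    "HOL-Algebra.Group_Action"
begin

definition unit_interval_space :: "real measure" where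
  "unit_interval_space = restrict_space lborel {0..1}"

(* The isomorphism is a Borel isomorphism on the nose, so the measurable sets of a
   standard probability space are its Borel sets. *)
definition standard_prob_space :: "'x measure \<Rightarrow> bool" where
  "standard_prob_space M \<longleftrightarrow>
     (\<exists>f. f \<in> M \<rightarrow>\<^sub>M unit_interval_space \<and>
          bij_betw f (space M) (space unit_interval_space) \<and>
          the_inv_into (space M) f \<in> unit_interval_space \<rightarrow>\<^sub>M M \<and>
          distr M unit_interval_space f = unit_interval_space)"

definition pmp_action ::
  "('g, 'r) monoid_scheme \<Rightarrow> 'x measure \<Rightarrow> ('g \<Rightarrow> 'x \<Rightarrow> 'x) \<Rightarrow> bool" where
  "pmp_action G M \<phi> \<longleftrightarrow>
     group_action G (space M) \<phi> \<and>
     (\<forall>g \<in> carrier G. \<phi> g \<in> M \<rightarrow>\<^sub>M M \<and> distr M M (\<phi> g) = M)"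

(* The filter expresses g going to infinity in G. *)
definition mixing_action ::
  "('g, 'r) monoid_scheme \<Rightarrow> 'x measure \<Rightarrow> ('g \<Rightarrow> 'x \<Rightarrow> 'x) \<Rightarrow> bool" where
  "mixing_action G M \<phi> \<longleftrightarrow>
     pmp_action G M \<phi> \<and>
     (\<forall>A \<in> sets M. \<forall>B \<in> sets M.
        ((\<lambda>g. measure M (\<phi> g ` A \<inter> B)) \<longlongrightarrow> measure M A * measure M B)
          (inf cofinite (principal (carrier G))))"

definition ergodic_action ::
  "('g, 'r) monoid_scheme \<Rightarrow> 'x measure \<Rightarrow> ('g \<Rightarrow> 'x \<Rightarrow> 'x) \<Rightarrow> bool" where
  "ergodic_action G M \<phi> \<longleftrightarrow>
     (\<forall>A \<in> sets M. (\<forall>g \<in> carrier G. \<phi> g ` A = A) \<longrightarrow> measure M A = 0 \<or> measure M A = 1)"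

definition free_action ::
  "('g, 'r) monoid_scheme \<Rightarrow> 'x measure \<Rightarrow> ('g \<Rightarrow> 'x \<Rightarrow> 'x) \<Rightarrow> bool" where
  "free_action G M \<phi> \<longleftrightarrow>
     (\<forall>g \<in> carrier G. g \<noteq> \<one>\<^bsub>G\<^esub> \<longrightarrow> (AE x in M. \<phi> g x \<noteq> x))"

(* Below, F-classes are the sets orbit G b0 x and E-classes the sets orbit D a0 x. *)

definition index_set :: "enat \<Rightarrow> nat set" where
  "index_set N = {n. enat n < N}"

definition transversal_at ::
  "('g, 'r) monoid_scheme \<Rightarrow> ('d, 's) monoid_scheme \<Rightarrow> ('g \<Rightarrow> 'x \<Rightarrow> 'x) \<Rightarrow> ('d \<Rightarrow> 'x \<Rightarrow> 'x)
     \<Rightarrow> enat \<Rightarrow> (nat \<Rightarrow> 'x \<Rightarrow> 'x) \<Rightarrow> 'x \<Rightarrow> bool" where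
  "transversal_at G D b0 a0 N C x \<longleftrightarrow>
     inj_on (\<lambda>n. C n x) (index_set N) \<and>
     (\<forall>n \<in> index_set N. C n x \<in> orbit G b0 x) \<and>
     (\<forall>y \<in> orbit G b0 x. \<exists>!n. n \<in> index_set N \<and> orbit D a0 (C n x) = orbit D a0 y)"

(* Every pointwise requirement on the choice functions, including being one-to-one,
   is imposed modulo null sets only. *)
definition choice_functions ::
  "('g, 'r) monoid_scheme \<Rightarrow> ('d, 's) monoid_scheme \<Rightarrow> 'x measure \<Rightarrow> ('g \<Rightarrow> 'x \<Rightarrow> 'x)
     \<Rightarrow> ('d \<Rightarrow> 'x \<Rightarrow> 'x) \<Rightarrow> enat \<Rightarrow> (nat \<Rightarrow> 'x \<Rightarrow> 'x) \<Rightarrow> bool" where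
  "choice_functions G D M b0 a0 N C \<longleftrightarrow>
     (\<forall>n \<in> index_set N. C n \<in> M \<rightarrow>\<^sub>M M) \<and>
     (AE x in M. C 0 x = x) \<and>
     (AE x in M. transversal_at G D b0 a0 N C x) \<and>
     (\<forall>n \<in> index_set N. \<exists>Z \<in> sets M. (AE x in M. x \<in> Z) \<and> inj_on (C n) Z)"

(* The F-invariant set of points on whose whole F-class the almost-everywhere
   hypotheses hold; it is conull since the groups are countable. *)
definition good_points ::
  "('g, 'r) monoid_scheme \<Rightarrow> ('d, 's) monoid_scheme \<Rightarrow> 'x measure \<Rightarrow> ('g \<Rightarrow> 'x \<Rightarrow> 'x)
     \<Rightarrow> ('d \<Rightarrow> 'x \<Rightarrow> 'x) \<Rightarrow> enat \<Rightarrow> (nat \<Rightarrow> 'x \<Rightarrow> 'x) \<Rightarrow> 'x set" where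
  "good_points G D M b0 a0 N C =
     {x \<in> space M. \<forall>x' \<in> orbit G b0 x.
        (\<forall>d \<in> carrier D. d \<noteq> \<one>\<^bsub>D\<^esub> \<longrightarrow> a0 d x' \<noteq> x') \<and>
        orbit D a0 x' \<subseteq> orbit G b0 x' \<and>
        transversal_at G D b0 a0 N C x'}"

definition index_perm ::
  "('d, 's) monoid_scheme \<Rightarrow> ('g \<Rightarrow> 'x \<Rightarrow> 'x) \<Rightarrow> ('d \<Rightarrow> 'x \<Rightarrow> 'x) \<Rightarrow> enat
     \<Rightarrow> (nat \<Rightarrow> 'x \<Rightarrow> 'x) \<Rightarrow> 'g \<Rightarrow> 'x \<Rightarrow> nat \<Rightarrow> nat" where
  "index_perm D b0 a0 N C g x k =
     (THE n. n \<in> index_set N \<and> orbit D a0 (C k x) = orbit D a0 (C n (b0 g x)))"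

definition index_perm_inv ::
  "('d, 's) monoid_scheme \<Rightarrow> ('g \<Rightarrow> 'x \<Rightarrow> 'x) \<Rightarrow> ('d \<Rightarrow> 'x \<Rightarrow> 'x) \<Rightarrow> enat
     \<Rightarrow> (nat \<Rightarrow> 'x \<Rightarrow> 'x) \<Rightarrow> 'g \<Rightarrow> 'x \<Rightarrow> nat \<Rightarrow> nat" where
  "index_perm_inv D b0 a0 N C g x =
     the_inv_into (index_set N) (index_perm D b0 a0 N C g x)"

definition delta_cocycle ::
  "('d, 's) monoid_scheme \<Rightarrow> ('g \<Rightarrow> 'x \<Rightarrow> 'x) \<Rightarrow> ('d \<Rightarrow> 'x \<Rightarrow> 'x) \<Rightarrow> enat
     \<Rightarrow> (nat \<Rightarrow> 'x \<Rightarrow> 'x) \<Rightarrow> 'g \<Rightarrow> 'x \<Rightarrow> nat \<Rightarrow> 'd" where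
  "delta_cocycle D b0 a0 N C g x n =
     (THE d. d \<in> carrier D \<and>
        a0 d (C (index_perm_inv D b0 a0 N C g x n) x) = C n (b0 g x))"

definition coind_space :: "'x measure \<Rightarrow> 'y measure \<Rightarrow> enat \<Rightarrow> ('x \<times> (nat \<Rightarrow> 'y)) measure" where
  "coind_space M M' N = M \<Otimes>\<^sub>M (\<Pi>\<^sub>M n \<in> index_set N. M')"

(* Off the good points, an invariant null set on which the formula need not make sense,
   the action is taken to be trivial, so that it is an action on the whole product. *)
definition coind_action ::
  "('g, 'r) monoid_scheme \<Rightarrow> ('d, 's) monoid_scheme \<Rightarrow> 'x measure \<Rightarrow> ('g \<Rightarrow> 'x \<Rightarrow> 'x)
     \<Rightarrow> ('d \<Rightarrow> 'x \<Rightarrow> 'x) \<Rightarrow> enat \<Rightarrow> (nat \<Rightarrow> 'x \<Rightarrow> 'x) \<Rightarrow> 'y measure \<Rightarrow> ('d \<Rightarrow> 'y \<Rightarrow> 'y)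
     \<Rightarrow> 'g \<Rightarrow> 'x \<times> (nat \<Rightarrow> 'y) \<Rightarrow> 'x \<times> (nat \<Rightarrow> 'y)" where
  "coind_action G D M b0 a0 N C M' a g =
     (\<lambda>(x, y) \<in> space (coind_space M M' N).
        if x \<in> good_points G D M b0 a0 N C
        then (b0 g x,
              \<lambda>n \<in> index_set N.
                a (delta_cocycle D b0 a0 N C g x n) (y (index_perm_inv D b0 a0 N C g x n)))
        else (x, y))"

end

theory Submission
  imports Defs "HOL-Probability.Probability"
begin

text \<open>
Why the co-induced action is mixing.  Write \<open>\<kappa> g x\<close> for the permutation of the index set \<open>I\<close> sending
\<open>n\<close> to the coordinate that \<open>g\<close> moves to position \<open>n\<close> above \<open>x\<close>, and \<open>\<delta> g x n\<close> for the element of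
\<open>D\<close> applied to it on the way.  For \<open>x\<close> outside an invariant null set both are determined by the
single equation \<open>a0 (\<delta> g x n) (C (\<kappa> g x n) x) = C n (b0 g x)\<close>, which has exactly one solution
(lemmas \<open>hit_exists\<close>, \<open>hit_unique\<close>).  Uniqueness gives the cocycle identities, so the formula
does define an action.

Mixing is a statement about sets that is stable under complements and countable disjoint unions in
either argument, so it suffices to check it on boxes \<open>A0 \<times> \<Pi> A\<^sub>i\<close> with finitely many proper factors
(\<open>mixing_action_from_generator\<close>).  Let \<open>K\<close> be a finite set of indices carrying the proper factors
of two boxes.  Above a fixed \<open>x\<close> the constraints
\<open>y\<^sub>i \<in> A\<^sub>i\<close> and \<open>a (\<delta> g x j) y\<^bsub>\<kappa> g x j\<^esub> \<in> B\<^sub>j\<close> involve independent coordinates, except that for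
\<open>j \<in> K\<close> with \<open>\<kappa> g x j \<in> K\<close> two of them meet in the same coordinate.  Hence the measure of the slice
differs from the product of the two cylinder measures by at most the sum over \<open>j \<in> K\<close> of the
correlation defects of \<open>A\<^bsub>\<kappa> g x j\<^esub>\<close> and \<open>B\<^sub>j\<close> under \<open>a (\<delta> g x j)\<close>
(\<open>wreath_map_correlation\<close>).

Since \<open>a\<close> is mixing, for each pair \<open>i, j\<close> in \<open>K\<close> the defect is small unless \<open>\<delta> g x j\<close> lies in a
fixed finite set of elements \<open>d\<close>.  The exceptional points are those with \<open>a0 d (C i x) = C j (b0 g x)\<close>.
For fixed \<open>i, j, d\<close> these sets are, modulo null sets, disjoint for different \<open>g\<close>: as \<open>C j\<close> is
one-to-one the equation determines \<open>b0 g x\<close>, and as \<open>b0\<close> is free this determines \<open>g\<close>.  In a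
probability space their measures therefore tend to 0 (\<open>hit_vanishes\<close>).  What remains after
integrating over \<open>x\<close> is the correlation of \<open>A0\<close> and \<open>B0\<close> under \<open>b0\<close> times a constant, and \<open>b0\<close> is
mixing (\<open>box_mixing\<close>).
\<close>

section \<open>Reducing mixing to a generator\<close>

text \<open>
A Dynkin-class argument.  The delicate case is a countable disjoint union, where limit and sum have
to be exchanged; the domination \<open>m g \<le> P\<close> provides the summable majorant for Tannery's theorem.
\<close>

lemma tendsto_measure_from_generator:
  fixes P :: "'a measure" and m :: "'g \<Rightarrow> 'a measure" and F :: "'g filter"
  assumes fin: "finite_measure P"
    and E: "Int_stable E" "E \<subseteq> Pow (space P)" "sets P = sigma_sets (space P) E" "space P \<in> E"
    and dom: "eventually (\<lambda>g. sets (m g) = sets P \<and>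
                (\<forall>A\<in>sets P. emeasure (m g) A \<le> emeasure P A)) F"
    and gen: "\<And>A. A \<in> E \<Longrightarrow> ((\<lambda>g. measure (m g) A) \<longlongrightarrow> c * measure P A) F"
    and A: "A \<in> sets P"
  shows "((\<lambda>g. measure (m g) A) \<longlongrightarrow> c * measure P A) F"
proof (cases "F = bot")
  case False
  interpret finite_measure P by fact
  have ev: "eventually (\<lambda>g. finite_measure (m g) \<and> sets (m g) = sets P \<and> space (m g) = space P \<and>
      (\<forall>A\<in>sets P. measure (m g) A \<le> measure P A)) F"
    using dom
  proof eventually_elim
    case (elim g)
    then have sp: "space (m g) = space P" by (metis sets_eq_imp_space_eq)
    have "finite_measure (m g)"
      using elim sp emeasure_finite[of "space P"] 
      by (intro finite_measureI) (metis sets.top top.extremum_unique infinity_ennreal_def)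
    moreover from this have "measure (m g) A \<le> measure P A" if "A \<in> sets P" for A
      unfolding measure_def using elim that by (intro enn2real_mono) (auto simp: less_top[symmetric])
    ultimately show ?case using elim sp by blast
  qed
  from A have "A \<in> sigma_sets (space P) E" by (simp add: E)
  with E(1,2) show ?thesis
  proof (induction rule: sigma_sets_induct_disjoint)
    case (basic A)
    then show ?case by (rule gen)
  next
    case empty
    show ?case by simp
  next
    case (compl A)
    then have A: "A \<in> sets P" by (simp add: E)
    have "((\<lambda>g. measure (m g) (space P) - measure (m g) A) \<longlongrightarrow>
        c * measure P (space P) - c * measure P A) F"
      by (intro tendsto_diff gen E compl)
    also have "c * measure P (space P) - c * measure P A = c * measure P (space P - A)"
      using A by (simp add: finite_measure_compl algebra_simps)
    finally show ?case
    proof (rule Lim_transform_eventually)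
      show "eventually (\<lambda>g. measure (m g) (space P) - measure (m g) A = measure (m g) (space P - A)) F"
        using ev by eventually_elim (metis A finite_measure.finite_measure_compl)
    qed
  next
    case (union A)
    then have A: "range A \<subseteq> sets P" by (simp add: E)
    have sums: "(\<lambda>i. measure P (A i)) sums measure P (\<Union>i. A i)"
      by (rule finite_measure_UNION[OF A union(1)])
    have "((\<lambda>g. \<Sum>i. measure (m g) (A i)) \<longlongrightarrow> (\<Sum>i. c * measure P (A i))) F"
    proof (rule tannerys_theorem[THEN conjunct2, THEN conjunct2])
      show "summable (\<lambda>i. measure P (A i))" using sums by (rule sums_summable)
      have "eventually (\<lambda>g. \<forall>A\<in>sets P. measure (m g) A \<le> measure P A) F"
        using ev by (auto elim: eventually_mono)
      from eventually_prodI[OF always_eventually[of "\<lambda>_. True"] this, of at_top]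
      have "eventually (\<lambda>kg. \<forall>A\<in>sets P. measure (m (snd kg)) A \<le> measure P A) (at_top \<times>\<^sub>F F)"
        by simp
      then show "eventually (\<lambda>(k, g). norm (measure (m g) (A k)) \<le> measure P (A k)) (at_top \<times>\<^sub>F F)"
        using A by (auto elim!: eventually_mono simp: split_beta)
    qed (use union False in auto)
    also have "(\<Sum>i. c * measure P (A i)) = c * measure P (\<Union>i. A i)"
      using sums by (simp add: suminf_mult sums_iff)
    finally show ?case
    proof (rule Lim_transform_eventually)
      show "eventually (\<lambda>g. (\<Sum>i. measure (m g) (A i)) = measure (m g) (\<Union>i. A i)) F"
        using ev
        by eventually_elim (metis A union(1) finite_measure.finite_measure_UNION sums_unique)
    qed
  qed
qed simp

lemma pmp_actionD:
  assumes "pmp_action G P T" "g \<in> carrier G"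
  shows "T g \<in> P \<rightarrow>\<^sub>M P" "\<And>A. A \<in> sets P \<Longrightarrow> emeasure P (T g -` A \<inter> space P) = emeasure P A"
    "\<And>A. A \<in> sets P \<Longrightarrow> measure P (T g -` A \<inter> space P) = measure P A"
    "\<And>Q. AE x in P. Q x \<Longrightarrow> AE x in P. Q (T g x)"
proof -
  show T: "T g \<in> P \<rightarrow>\<^sub>M P" using assms by (auto simp: pmp_action_def)
  have d: "distr P P (T g) = P" using assms by (auto simp: pmp_action_def)
  show e: "emeasure P (T g -` A \<inter> space P) = emeasure P A" if "A \<in> sets P" for A
    using emeasure_distr[OF T that] d by simp
  show "measure P (T g -` A \<inter> space P) = measure P A" if "A \<in> sets P" for A
    using e[OF that] by (simp add: measure_def)
  show "AE x in P. Q (T g x)" if "AE x in P. Q x" for Q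
    using AE_distrD[OF T, of Q] that unfolding d by blast
qed

text \<open>
Correlations in terms of preimages, which stay measurable and can be sliced, instead of the images
used in the definition of mixing.
\<close>

lemma pmp_action_measure_image_Int:
  assumes pmp: "pmp_action G P T" and g: "g \<in> carrier G" and A: "A \<in> sets P" and B: "B \<in> sets P"
  shows "measure P (T g ` A \<inter> B) = measure P (A \<inter> (T g -` B \<inter> space P))"
proof -
  interpret group_action G "space P" T using pmp by (simp add: pmp_action_def)
  interpret group G using group_hom group_hom.axioms(1) by auto
  have i: "inv\<^bsub>G\<^esub> g \<in> carrier G" using g by simp
  let ?X = "A \<inter> (T g -` B \<inter> space P)"
  have X: "?X \<in> sets P" using A B pmp_actionD(1)[OF pmp g] by (auto intro: measurable_sets)
  have "T g ` A \<inter> B = T (inv\<^bsub>G\<^esub> g) -` ?X \<inter> space P"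
  proof (intro equalityI subsetI)
    fix y assume "y \<in> T g ` A \<inter> B"
    then obtain x where x: "x \<in> A" "y = T g x" "y \<in> B" by auto
    then have xs: "x \<in> space P" using A sets.sets_into_space by auto
    have "T (inv\<^bsub>G\<^esub> g) y = x" using orbit_sym_aux[OF g xs] x by simp
    then show "y \<in> T (inv\<^bsub>G\<^esub> g) -` ?X \<inter> space P"
      using x xs element_image[OF g xs] by auto
  next
    fix y assume y: "y \<in> T (inv\<^bsub>G\<^esub> g) -` ?X \<inter> space P"
    then have "T g (T (inv\<^bsub>G\<^esub> g) y) = y" 
      using orbit_sym_aux[OF i, of y] g by simp
    then show "y \<in> T g ` A \<inter> B" using y by force
  qed
  then show ?thesis using pmp_actionD(3)[OF pmp i X] by simp
qed

lemma eventually_group_infinity: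
  "eventually Q (inf cofinite (principal S)) \<longleftrightarrow> finite {g \<in> S. \<not> Q g}"
  by (simp add: eventually_inf_principal eventually_cofinite conj_commute)

text \<open>
Apply \<open>tendsto_measure_from_generator\<close> once in each variable.  With \<open>A\<close> in the generator fixed, the
correlation as a function of \<open>B\<close> is the image under \<open>T g\<close> of \<open>P\<close> restricted to \<open>A\<close>; with \<open>B\<close>
fixed, it is as a function of \<open>A\<close> the restriction of \<open>P\<close> to the preimage of \<open>B\<close>.  Both are dominated
by \<open>P\<close>, the first one by invariance.
\<close>

lemma mixing_action_from_generator:
  fixes G :: "('g, 'r) monoid_scheme" and P :: "'x measure"
  defines "F \<equiv> inf cofinite (principal (carrier G))"
  assumes prob: "prob_space P" and pmp: "pmp_action G P T"
    and E: "Int_stable E" "E \<subseteq> Pow (space P)" "sets P = sigma_sets (space P) E" "space P \<in> E"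
    and mix: "\<And>A B. A \<in> E \<Longrightarrow> B \<in> E \<Longrightarrow>
      ((\<lambda>g. measure P (A \<inter> (T g -` B \<inter> space P))) \<longlongrightarrow> measure P A * measure P B) F"
  shows "mixing_action G P T"
proof -
  interpret prob_space P by fact
  have evG: "eventually (\<lambda>g. g \<in> carrier G) F"
    by (simp add: F_def eventually_inf_principal)
  have fin: "finite_measure P" by unfold_locales
  have Es: "A \<in> sets P" if "A \<in> E" for A using that E by auto
  have mT: "T g \<in> P \<rightarrow>\<^sub>M P" if "g \<in> carrier G" for g
    using pmp_actionD(1)[OF pmp that] .
  have m1: "((\<lambda>g. measure P (A \<inter> (T g -` B \<inter> space P))) \<longlongrightarrow> measure P A * measure P B) F"
    if A: "A \<in> E" and B: "B \<in> sets P" for A B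
  proof -
    let ?m = "\<lambda>g. distr (density P (indicator A)) P (T g)"
    have em: "emeasure (?m g) X = emeasure P (A \<inter> (T g -` X \<inter> space P))"
      if "g \<in> carrier G" "X \<in> sets P" for g X
      using that mT[of g] Es[OF A]
      by (subst emeasure_distr) (auto simp: emeasure_restricted intro!: measurable_sets)
    have "((\<lambda>g. measure (?m g) B) \<longlongrightarrow> measure P A * measure P B) F"
    proof (rule tendsto_measure_from_generator[OF fin E _ _ B])
      show "eventually (\<lambda>g. sets (?m g) = sets P \<and> (\<forall>X\<in>sets P. emeasure (?m g) X \<le> emeasure P X)) F"
        using evG
      proof eventually_elim
        case (elim g)
        have "emeasure (?m g) X \<le> emeasure P X" if "X \<in> sets P" for X
        proof -
          have "emeasure (?m g) X \<le> emeasure P (T g -` X \<inter> space P)"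
            unfolding em[OF elim that] using mT[OF elim] that by (intro emeasure_mono measurable_sets) auto
          then show ?thesis using pmp_actionD(2)[OF pmp elim that] by simp
        qed
        then show ?case by simp
      qed
      fix X assume "X \<in> E"
      show "((\<lambda>g. measure (?m g) X) \<longlongrightarrow> measure P A * measure P X) F"
        by (rule Lim_transform_eventually[OF mix[OF A \<open>X \<in> E\<close>]])
          (use em Es[OF \<open>X \<in> E\<close>] in \<open>auto simp: measure_def intro: eventually_mono[OF evG]\<close>)
    qed
    then show ?thesis
      by (rule Lim_transform_eventually) (use em B in \<open>auto simp: measure_def intro: eventually_mono[OF evG]\<close>)
  qed
  have m2: "((\<lambda>g. measure P (A \<inter> (T g -` B \<inter> space P))) \<longlongrightarrow> measure P A * measure P B) F"
    if A: "A \<in> sets P" and B: "B \<in> sets P" for A B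
  proof -
    let ?m = "\<lambda>g. density P (indicator (T g -` B \<inter> space P))"
    have em: "emeasure (?m g) X = emeasure P (X \<inter> (T g -` B \<inter> space P))"
      if "g \<in> carrier G" "X \<in> sets P" for g X
      using that mT[of g] B
      by (subst emeasure_restricted) (auto simp: Int_commute Int_left_commute intro!: measurable_sets)
    have "((\<lambda>g. measure (?m g) A) \<longlongrightarrow> measure P B * measure P A) F"
    proof (rule tendsto_measure_from_generator[OF fin E _ _ A])
      show "eventually (\<lambda>g. sets (?m g) = sets P \<and> (\<forall>X\<in>sets P. emeasure (?m g) X \<le> emeasure P X)) F"
        using evG
      proof eventually_elim
        case (elim g)
        have "emeasure (?m g) X \<le> emeasure P X" if "X \<in> sets P" for X
          unfolding em[OF elim that] using that by (intro emeasure_mono) auto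
        then show ?case by simp
      qed
      fix X assume "X \<in> E"
      from m1[OF this B] have "((\<lambda>g. measure P (X \<inter> (T g -` B \<inter> space P))) \<longlongrightarrow> measure P B * measure P X) F"
        by (simp add: mult.commute)
      then show "((\<lambda>g. measure (?m g) X) \<longlongrightarrow> measure P B * measure P X) F"
        by (rule Lim_transform_eventually)
          (use em Es[OF \<open>X \<in> E\<close>] in \<open>auto simp: measure_def intro: eventually_mono[OF evG]\<close>)
    qed
    then have "((\<lambda>g. measure (?m g) A) \<longlongrightarrow> measure P A * measure P B) F"
      by (simp add: mult.commute)
    then show ?thesis
      by (rule Lim_transform_eventually) (use em A in \<open>auto simp: measure_def intro: eventually_mono[OF evG]\<close>)
  qed
  have "((\<lambda>g. measure P (T g ` A \<inter> B)) \<longlongrightarrow> measure P A * measure P B) F"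
    if "A \<in> sets P" and "B \<in> sets P" for A B
    using that by (intro Lim_transform_eventually[OF m2] eventually_mono[OF evG])
      (simp_all add: pmp_action_measure_image_Int[OF pmp])
  then show ?thesis using pmp by (simp add: mixing_action_def F_def)
qed

section \<open>Standard probability spaces\<close>

lemma standard_prob_space_prob_space:
  assumes "standard_prob_space M"
  shows "prob_space M"
proof -
  obtain f where f: "f \<in> M \<rightarrow>\<^sub>M unit_interval_space" "distr M unit_interval_space f = unit_interval_space"
    using assms unfolding standard_prob_space_def by blast
  have "prob_space unit_interval_space"
    unfolding unit_interval_space_def by (intro prob_spaceI) (simp add: emeasure_restrict_space space_restrict_space)
  then show ?thesis
    using prob_space_distrD[OF f(1)] unfolding f(2) by blast
qed

text \<open>
A Borel isomorphism to the unit interval turns an equation between points into an equation between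
real numbers.  Through it orbit relations, and with them the cocycle, become measurable.
\<close>

lemma standard_prob_space_eq_measurable:
  assumes "standard_prob_space M" "f \<in> K \<rightarrow>\<^sub>M M" "h \<in> K \<rightarrow>\<^sub>M M"
  shows "{x \<in> space K. f x = h x} \<in> sets K"
proof -
  obtain \<phi> where \<phi>: "\<phi> \<in> M \<rightarrow>\<^sub>M unit_interval_space"
    and bij: "bij_betw \<phi> (space M) (space unit_interval_space)"
    using assms unfolding standard_prob_space_def by blast
  have b[measurable]: "\<phi> \<in> M \<rightarrow>\<^sub>M borel" using \<phi>
    unfolding unit_interval_space_def measurable_restrict_space2_iff by auto
  have [measurable]: "f \<in> K \<rightarrow>\<^sub>M M" "h \<in> K \<rightarrow>\<^sub>M M" by fact+
  have "{x \<in> space K. f x = h x} = {x \<in> space K. \<phi> (f x) = \<phi> (h x)}"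
    using bij measurable_space[OF assms(2)] measurable_space[OF assms(3)]
    by (auto simp: bij_betw_def inj_on_def)
  also have "\<dots> \<in> sets K" by measurable
  finally show ?thesis .
qed

section \<open>Cylinders and boxes\<close>

text \<open>
A cylinder is given by a whole family of factors, almost all of them trivial, so that it is simply
\<open>Pi\<^sub>E I A\<close> and two cylinders intersect factor by factor.
\<close>

definition cylinder_family :: "'i set \<Rightarrow> 'y measure \<Rightarrow> ('i \<Rightarrow> 'y set) \<Rightarrow> bool" where
  "cylinder_family I M' A \<longleftrightarrow>
     (\<forall>i\<in>I. A i \<in> sets M') \<and> finite {i \<in> I. A i \<noteq> space M'}"

lemma cylinder_family_space: "cylinder_family I M' (\<lambda>_. space M')"
  by (simp add: cylinder_family_def)

lemma cylinder_family_Int: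
  assumes "cylinder_family I M' A" "cylinder_family I M' B"
  shows "cylinder_family I M' (\<lambda>i. A i \<inter> B i)"
proof -
  have "finite ({i \<in> I. A i \<noteq> space M'} \<union> {i \<in> I. B i \<noteq> space M'})"
    using assms by (simp add: cylinder_family_def)
  then have "finite {i \<in> I. A i \<inter> B i \<noteq> space M'}"
    by (rule rev_finite_subset) auto
  then show ?thesis using assms by (auto simp: cylinder_family_def)
qed

lemma PiE_cylinder_eq_prod_emb:
  assumes "cylinder_family I M' A" "finite K" "K \<subseteq> I" "\<And>i. i \<in> I - K \<Longrightarrow> A i = space M'"
  shows "Pi\<^sub>E I A = prod_emb I (\<lambda>_. M') K (Pi\<^sub>E K A)"
proof (intro equalityI subsetI)
  fix y assume "y \<in> Pi\<^sub>E I A"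
  moreover have "A i \<subseteq> space M'" if "i \<in> I" for i
    using assms(1) that sets.sets_into_space by (auto simp: cylinder_family_def)
  ultimately show "y \<in> prod_emb I (\<lambda>_. M') K (Pi\<^sub>E K A)"
    using assms(3) by (fastforce simp: prod_emb_def PiE_iff)
next
  fix y assume "y \<in> prod_emb I (\<lambda>_. M') K (Pi\<^sub>E K A)"
  then have y: "y \<in> extensional I" "\<And>i. i \<in> I \<Longrightarrow> y i \<in> space M'" "\<And>i. i \<in> K \<Longrightarrow> y i \<in> A i"
    by (auto simp: prod_emb_def PiE_iff)
  have "y i \<in> A i" if "i \<in> I" for i
    using y(2,3)[of i] assms(4)[of i] that by (cases "i \<in> K") auto
  then show "y \<in> Pi\<^sub>E I A" using y(1) by (auto simp: PiE_iff)
qed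

lemma sets_PiE_cylinder:
  assumes "cylinder_family I M' A"
  shows "Pi\<^sub>E I A \<in> sets (\<Pi>\<^sub>M i\<in>I. M')"
proof -
  let ?K = "{i \<in> I. A i \<noteq> space M'}"
  have "Pi\<^sub>E I A = prod_emb I (\<lambda>_. M') ?K (Pi\<^sub>E ?K A)"
    using assms by (intro PiE_cylinder_eq_prod_emb) (auto simp: cylinder_family_def)
  then show ?thesis using assms by (auto simp: cylinder_family_def intro!: sets_PiM_I)
qed

lemma measure_PiE_cylinder:
  assumes "prob_space M'"
    and "cylinder_family I M' A" "finite K" "K \<subseteq> I" "\<And>i. i \<in> I - K \<Longrightarrow> A i = space M'"
  shows "measure (\<Pi>\<^sub>M i\<in>I. M') (Pi\<^sub>E I A) = (\<Prod>i\<in>K. measure M' (A i))"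
proof -
  interpret M': prob_space M' by fact
  interpret product_prob_space "\<lambda>_. M'" I by unfold_locales
  have "Pi\<^sub>E I A = prod_emb I (\<lambda>_. M') K (Pi\<^sub>E K A)"
    using assms(2-) by (rule PiE_cylinder_eq_prod_emb)
  moreover have "A i \<in> sets M'" if "i \<in> K" for i
    using assms that by (auto simp: cylinder_family_def)
  ultimately show ?thesis
    using assms(3,4) by (simp add: measure_PiM_emb)
qed

section \<open>Correlations under a coordinate permutation twisted in each factor\<close>

text \<open>
The action of the element \<open>(t, \<kappa>)\<close> of the unrestricted wreath product with \<open>Sym I\<close>.
\<close>

definition wreath_map :: "'i set \<Rightarrow> ('i \<Rightarrow> 'i) \<Rightarrow> ('i \<Rightarrow> 'y \<Rightarrow> 'y) \<Rightarrow> ('i \<Rightarrow> 'y) \<Rightarrow> 'i \<Rightarrow> 'y" where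
  "wreath_map I \<kappa> t y = (\<lambda>n\<in>I. t n (y (\<kappa> n)))"

text \<open>
The intersection is again a cylinder: with \<open>\<tau>\<close> the inverse of \<open>\<kappa>\<close>, its factor at \<open>i\<close> is \<open>A i\<close>
intersected with \<open>S i\<close>, the preimage of \<open>B (\<tau> i)\<close> under \<open>t (\<tau> i)\<close>.  Both quantities on the left
are thus finite products of numbers in \<open>[0, 1]\<close>, over \<open>i \<in> K \<union> \<kappa> ` K\<close>, and two such products differ
by at most the sum of the differences of their factors.  A factor with \<open>i \<notin> \<kappa> ` K\<close> contributes
nothing, because \<open>S i\<close> is then the whole space.
\<close>

lemma wreath_map_correlation:
  fixes M' :: "'y measure"
  assumes prob: "prob_space M'" and \<kappa>: "bij_betw \<kappa> I I"
    and t: "\<And>n. n \<in> I \<Longrightarrow> t n \<in> M' \<rightarrow>\<^sub>M M'"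
    and pres: "\<And>n X. n \<in> I \<Longrightarrow> X \<in> sets M' \<Longrightarrow> measure M' (t n -` X \<inter> space M') = measure M' X"
    and A: "cylinder_family I M' A" "\<And>i. i \<in> I - K \<Longrightarrow> A i = space M'"
    and B: "cylinder_family I M' B" "\<And>i. i \<in> I - K \<Longrightarrow> B i = space M'"
    and K: "finite K" "K \<subseteq> I"
  defines "P \<equiv> \<Pi>\<^sub>M i\<in>I. M'"
  shows "\<bar>measure P (Pi\<^sub>E I A \<inter> {y \<in> space P. wreath_map I \<kappa> t y \<in> Pi\<^sub>E I B}) -
            measure P (Pi\<^sub>E I A) * measure P (Pi\<^sub>E I B)\<bar>
    \<le> (\<Sum>j\<in>K. \<bar>measure M' (A (\<kappa> j) \<inter> (t j -` B j \<inter> space M')) -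
                 measure M' (A (\<kappa> j)) * measure M' (B j)\<bar>)"
proof -
  interpret prob_space M' by fact
  define \<tau> where "\<tau> = the_inv_into I \<kappa>"
  have inj: "inj_on \<kappa> I" and im: "\<kappa> ` I = I" using \<kappa> by (auto simp: bij_betw_def)
  have \<tau>\<kappa>: "\<tau> (\<kappa> n) = n" if "n \<in> I" for n
    using that inj by (simp add: \<tau>_def the_inv_into_f_f)
  have \<kappa>\<tau>: "\<kappa> (\<tau> i) = i" "\<tau> i \<in> I" if "i \<in> I" for i
    using that inj im by (simp_all add: \<tau>_def f_the_inv_into_f the_inv_into_into)
  have \<kappa>I: "\<kappa> n \<in> I" if "n \<in> I" for n using that im by auto
  define S where "S i = t (\<tau> i) -` B (\<tau> i) \<inter> space M'" for i
  define L where "L = K \<union> \<kappa> ` K"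
  have L: "finite L" "L \<subseteq> I" using K \<kappa>I by (auto simp: L_def)
  have As: "A i \<in> sets M'" and Bs: "B i \<in> sets M'" if "i \<in> I" for i
    using A B that by (auto simp: cylinder_family_def)
  have Ss: "S i \<in> sets M'" if "i \<in> I" for i
    unfolding S_def using t \<kappa>\<tau> Bs that by (intro measurable_sets) auto
  have Sm: "measure M' (S i) = measure M' (B (\<tau> i))" if "i \<in> I" for i
    unfolding S_def using pres \<kappa>\<tau> Bs that by auto
  \<comment> \<open>Injectivity of \<open>\<kappa>\<close>: outside \<open>\<kappa> ` K\<close> the index \<open>\<tau> i\<close> is outside \<open>K\<close>, where \<open>B\<close> is trivial.\<close>
  have S_out: "S i = space M'" if "i \<in> I" "i \<notin> \<kappa> ` K" for i
  proof -
    have "\<tau> i \<notin> K" using that \<kappa>\<tau> by force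
    then show ?thesis using B(2)[of "\<tau> i"] \<kappa>\<tau>[OF that(1)] measurable_space[OF t]
      by (auto simp: S_def)
  qed
  have S: "cylinder_family I M' S"
    unfolding cylinder_family_def using Ss S_out L
    by (auto intro: finite_subset[of _ "\<kappa> ` K"] simp: K)
  have "Pi\<^sub>E I A \<inter> {y \<in> space P. wreath_map I \<kappa> t y \<in> Pi\<^sub>E I B} = Pi\<^sub>E I (\<lambda>i. A i \<inter> S i)"
  proof (intro equalityI subsetI)
    fix y assume y: "y \<in> Pi\<^sub>E I A \<inter> {y \<in> space P. wreath_map I \<kappa> t y \<in> Pi\<^sub>E I B}"
    have "y i \<in> S i" if "i \<in> I" for i
    proof -
      have "wreath_map I \<kappa> t y (\<tau> i) \<in> B (\<tau> i)" using y \<kappa>\<tau>(2)[OF that] by (auto simp: PiE_iff)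
      then show ?thesis using y \<kappa>\<tau>[OF that] that by (auto simp: wreath_map_def S_def P_def space_PiM PiE_iff)
    qed
    then show "y \<in> Pi\<^sub>E I (\<lambda>i. A i \<inter> S i)" using y by (auto simp: PiE_iff)
  next
    fix y assume y: "y \<in> Pi\<^sub>E I (\<lambda>i. A i \<inter> S i)"
    have "t n (y (\<kappa> n)) \<in> B n" if "n \<in> I" for n
      using y \<kappa>I[OF that] \<tau>\<kappa>[OF that] by (auto simp: PiE_iff S_def)
    then show "y \<in> Pi\<^sub>E I A \<inter> {y \<in> space P. wreath_map I \<kappa> t y \<in> Pi\<^sub>E I B}"
      using y by (auto simp: PiE_iff P_def space_PiM wreath_map_def S_def)
  qed
  moreover have "measure P (Pi\<^sub>E I (\<lambda>i. A i \<inter> S i)) = (\<Prod>i\<in>L. measure M' (A i \<inter> S i))"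
    unfolding P_def using A(2) S_out
    by (intro measure_PiE_cylinder[OF prob cylinder_family_Int[OF A(1) S] L]) (auto simp: L_def)
  ultimately have "measure P (Pi\<^sub>E I A \<inter> {y \<in> space P. wreath_map I \<kappa> t y \<in> Pi\<^sub>E I B}) =
      (\<Prod>i\<in>L. measure M' (A i \<inter> S i))"
    by simp
  moreover have "measure P (Pi\<^sub>E I A) * measure P (Pi\<^sub>E I B) =
      (\<Prod>i\<in>L. measure M' (A i) * measure M' (S i))"
  proof -
    have "(\<Prod>i\<in>L. measure M' (S i)) = (\<Prod>i\<in>\<kappa> ` K. measure M' (S i))"
      using L S_out by (intro prod.mono_neutral_right) (auto simp: L_def prob_space)
    also have "\<dots> = (\<Prod>j\<in>K. measure M' (S (\<kappa> j)))"
      using inj K by (subst prod.reindex) (auto intro: inj_on_subset)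
    also have "\<dots> = (\<Prod>j\<in>K. measure M' (B j))"
      using K \<kappa>I \<tau>\<kappa> Sm by (intro prod.cong) auto
    also have "\<dots> = measure P (Pi\<^sub>E I B)"
      unfolding P_def by (rule measure_PiE_cylinder[OF prob B(1) K B(2), symmetric])
    finally have "(\<Prod>i\<in>L. measure M' (S i)) = measure P (Pi\<^sub>E I B)" .
    moreover have "measure P (Pi\<^sub>E I A) = (\<Prod>i\<in>L. measure M' (A i))"
      unfolding P_def using A(2) by (intro measure_PiE_cylinder[OF prob A(1) L]) (auto simp: L_def)
    ultimately show ?thesis by (simp add: prod.distrib)
  qed
  moreover have "\<bar>(\<Prod>i\<in>L. measure M' (A i \<inter> S i)) - (\<Prod>i\<in>L. measure M' (A i) * measure M' (S i))\<bar>
      \<le> (\<Sum>i\<in>L. \<bar>measure M' (A i \<inter> S i) - measure M' (A i) * measure M' (S i)\<bar>)"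
    using norm_prod_diff[of L "\<lambda>i. measure M' (A i \<inter> S i)" "\<lambda>i. measure M' (A i) * measure M' (S i)"]
    by (simp add: mult_le_one)
  moreover have "(\<Sum>i\<in>L. \<bar>measure M' (A i \<inter> S i) - measure M' (A i) * measure M' (S i)\<bar>) =
      (\<Sum>i\<in>\<kappa> ` K. \<bar>measure M' (A i \<inter> S i) - measure M' (A i) * measure M' (S i)\<bar>)"
  proof (rule sum.mono_neutral_right)
    show "\<forall>i\<in>L - \<kappa> ` K. \<bar>measure M' (A i \<inter> S i) - measure M' (A i) * measure M' (S i)\<bar> = 0"
      using L S_out As sets.Int_space_eq2 by (auto simp: prob_space)
  qed (use L in \<open>auto simp: L_def\<close>)
  moreover have "\<dots> = (\<Sum>j\<in>K. \<bar>measure M' (A (\<kappa> j) \<inter> S (\<kappa> j)) - measure M' (A (\<kappa> j)) * measure M' (S (\<kappa> j))\<bar>)"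
    using inj K by (subst sum.reindex) (auto intro: inj_on_subset)
  moreover have "\<dots> = (\<Sum>j\<in>K. \<bar>measure M' (A (\<kappa> j) \<inter> (t j -` B j \<inter> space M')) -
                 measure M' (A (\<kappa> j)) * measure M' (B j)\<bar>)"
  proof (rule sum.cong[OF refl])
    fix j assume "j \<in> K"
    then have j: "j \<in> I" using K by auto
    have "S (\<kappa> j) = t j -` B j \<inter> space M'" by (simp add: S_def \<tau>\<kappa>[OF j])
    moreover have "measure M' (S (\<kappa> j)) = measure M' (B j)" using Sm[OF \<kappa>I[OF j]] \<tau>\<kappa>[OF j] by simp
    ultimately show "\<bar>measure M' (A (\<kappa> j) \<inter> S (\<kappa> j)) - measure M' (A (\<kappa> j)) * measure M' (S (\<kappa> j))\<bar> =
      \<bar>measure M' (A (\<kappa> j) \<inter> (t j -` B j \<inter> space M')) - measure M' (A (\<kappa> j)) * measure M' (B j)\<bar>"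
      by simp
  qed
  ultimately show ?thesis by linarith
qed

definition boxes :: "'x measure \<Rightarrow> 'y measure \<Rightarrow> 'i set \<Rightarrow> ('x \<times> ('i \<Rightarrow> 'y)) set set" where
  "boxes M M' I = {A0 \<times> Pi\<^sub>E I A |A0 A. A0 \<in> sets M \<and> cylinder_family I M' A}"

lemma boxes_generate:
  fixes M :: "'x measure" and M' :: "'y measure" and I :: "'i set"
  defines "P \<equiv> M \<Otimes>\<^sub>M (\<Pi>\<^sub>M i\<in>I. M')"
  shows "Int_stable (boxes M M' I)"
    and "boxes M M' I \<subseteq> Pow (space P)"
    and "sets P = sigma_sets (space P) (boxes M M' I)"
    and "space P \<in> boxes M M' I"
proof -
  let ?Q = "\<Pi>\<^sub>M i\<in>I. M'"
  let ?C = "{Pi\<^sub>E I A |A. cylinder_family I M' A}"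
  have spQ: "space ?Q \<in> ?C" 
    using cylinder_family_space[of I M'] by (auto simp: space_PiM)
  show "Int_stable (boxes M M' I)"
  proof (rule Int_stableI)
    fix a b assume "a \<in> boxes M M' I" "b \<in> boxes M M' I"
    then obtain A0 A B0 B where "a = A0 \<times> Pi\<^sub>E I A" "b = B0 \<times> Pi\<^sub>E I B"
      "A0 \<in> sets M" "B0 \<in> sets M" "cylinder_family I M' A" "cylinder_family I M' B"
      unfolding boxes_def by blast
    then show "a \<inter> b \<in> boxes M M' I"
      unfolding boxes_def using cylinder_family_Int[of I M' A B]
      by (auto simp: Times_Int_Times PiE_Int intro!: exI[of _ "A0 \<inter> B0"] exI[of _ "\<lambda>i. A i \<inter> B i"])
  qed
  show "space P \<in> boxes M M' I"
    using spQ by (auto simp: P_def space_pair_measure boxes_def)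
  have C: "?C \<subseteq> sets ?Q" using sets_PiE_cylinder by blast
  have setsQ: "sets ?Q = sigma_sets (space ?Q) ?C"
  proof (rule antisym)
    show "sigma_sets (space ?Q) ?C \<subseteq> sets ?Q"
      using C by (rule sets.sigma_sets_subset)
    have "{f \<in> \<Pi>\<^sub>E i\<in>I. space M'. f i \<in> A} \<in> ?C" if "i \<in> I" "A \<in> sets M'" for i A
    proof -
      let ?A = "\<lambda>j. if j = i then A else space M'"
      have "finite {j \<in> I. ?A j \<noteq> space M'}"
        by (rule finite_subset[of _ "{i}"]) auto
      then have "cylinder_family I M' ?A"
        using that by (auto simp: cylinder_family_def)
      moreover have "(\<forall>j\<in>I. f j \<in> ?A j) \<longleftrightarrow> (\<forall>j\<in>I. f j \<in> space M') \<and> f i \<in> A" for f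
        using that(1) sets.sets_into_space[OF that(2)] by (smt (verit) subsetD)
      then have "{f \<in> \<Pi>\<^sub>E i\<in>I. space M'. f i \<in> A} = Pi\<^sub>E I ?A"
        unfolding PiE_iff set_eq_iff mem_Collect_eq by blast
      ultimately show ?thesis by blast
    qed
    then show "sets ?Q \<subseteq> sigma_sets (space ?Q) ?C"
      unfolding sets_PiM_single space_PiM by (intro sigma_sets_mono') blast
  qed
  have "sets P = sets (sigma (space M \<times> space ?Q) {a \<times> b |a b. a \<in> sets M \<and> b \<in> ?C})"
    unfolding P_def
  proof (rule sets_pair_eq)
    show "sets M \<subseteq> Pow (space M)" by (rule sets.space_closed)
    show "sets M = sigma_sets (space M) (sets M)" by (simp add: sets.sigma_sets_eq)
    show "?C \<subseteq> Pow (space ?Q)" using C sets.sets_into_space by blast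
    show "sets ?Q = sigma_sets (space ?Q) ?C" by (rule setsQ)
    show "countable {space M}" "{space M} \<subseteq> sets M" "\<Union>{space M} = space M" by auto
    show "countable {space ?Q}" "{space ?Q} \<subseteq> ?C" "\<Union>{space ?Q} = space ?Q" using spQ by auto
  qed
  also have "{a \<times> b |a b. a \<in> sets M \<and> b \<in> ?C} = boxes M M' I"
    unfolding boxes_def by blast
  finally have *: "sets P = sets (sigma (space M \<times> space ?Q) (boxes M M' I))" .
  have "boxes M M' I \<subseteq> sets P"
    unfolding boxes_def P_def using sets_PiE_cylinder by blast
  then show sub: "boxes M M' I \<subseteq> Pow (space P)"
    using sets.sets_into_space by blast
  show "sets P = sigma_sets (space P) (boxes M M' I)"
    using * sub by (simp add: P_def space_pair_measure)
qed

section \<open>Disjoint sets and slices\<close>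

text \<open>
At most \<open>measure M (space M) / e\<close> disjoint sets can have measure at least \<open>e\<close>.
\<close>

lemma disjoint_measure_vanishes:
  assumes "finite_measure M" and sets: "\<And>g. g \<in> S \<Longrightarrow> H g \<in> sets M"
    and disj: "disjoint_family_on H S"
  shows "((\<lambda>g. measure M (H g)) \<longlongrightarrow> 0) (inf cofinite (principal S))"
proof (rule tendstoI)
  interpret finite_measure M by fact
  fix e :: real assume e: "e > 0"
  let ?B = "{g \<in> S. \<not> dist (measure M (H g)) 0 < e}"
  obtain k :: nat where k: "measure M (space M) / e < real k" using reals_Archimedean2 by blast
  have "card F \<le> k" if "F \<subseteq> ?B" "finite F" for F
  proof -
    have "real (card F) * e \<le> (\<Sum>g\<in>F. measure M (H g))"
      using that by (intro sum_bounded_below) (auto simp: not_less)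
    also have "\<dots> = measure M (\<Union>g\<in>F. H g)"
      using that sets disj
      by (intro finite_measure_finite_Union[symmetric]) (auto intro: disjoint_family_on_mono)
    also have "\<dots> \<le> measure M (space M)" by (rule bounded_measure)
    also have "\<dots> \<le> real k * e" using k e by (simp add: field_simps)
    finally show ?thesis using e by simp
  qed
  then have "finite ?B"
    by (meson finite_if_finite_subsets_card_bdd)
  then show "eventually (\<lambda>g. dist (measure M (H g)) 0 < e) (inf cofinite (principal S))"
    by (simp add: eventually_group_infinity)
qed

lemma measure_pair_eq_integral_slices:
  assumes "prob_space M" "prob_space K" and X: "X \<in> sets (M \<Otimes>\<^sub>M K)"
  shows "integrable M (\<lambda>x. measure K (Pair x -` X))"
    and "measure (M \<Otimes>\<^sub>M K) X = (\<integral>x. measure K (Pair x -` X) \<partial>M)"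
proof -
  interpret M: prob_space M by fact
  interpret K: prob_space K by fact
  have m: "(\<lambda>x. measure K (Pair x -` X)) \<in> borel_measurable M"
    unfolding measure_def using K.measurable_emeasure_Pair[OF X] by measurable
  show int: "integrable M (\<lambda>x. measure K (Pair x -` X))"
    by (rule M.integrable_const_bound[where B = 1]) (use m in auto)
  have "emeasure (M \<Otimes>\<^sub>M K) X = (\<integral>\<^sup>+x. ennreal (measure K (Pair x -` X)) \<partial>M)"
    unfolding K.emeasure_pair_measure_alt[OF X] by (simp add: K.emeasure_eq_measure)
  also have "\<dots> = ennreal (\<integral>x. measure K (Pair x -` X) \<partial>M)"
    using int by (intro nn_integral_eq_integral) auto
  finally show "measure (M \<Otimes>\<^sub>M K) X = (\<integral>x. measure K (Pair x -` X) \<partial>M)"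
    by (simp add: measure_def integral_nonneg_AE)
qed


section \<open>The co-induced cocycle\<close>

lemma (in group_action) orbit_eqI:
  assumes "x \<in> E" "y \<in> orbit G \<phi> x"
  shows "orbit G \<phi> y = orbit G \<phi> x"
proof -
  have y: "y \<in> E" using assms element_image by (auto simp: orbit_def)
  have sub: "orbit G \<phi> z \<subseteq> E" if "z \<in> E" for z
    using that element_image by (auto simp: orbit_def)
  show ?thesis
    using orbit_trans[OF assms(1) y _ assms(2)] orbit_trans[OF y assms(1) _ orbit_sym[OF assms(1) y assms(2)]]
      sub[OF y] sub[OF assms(1)] by blast
qed

lemma (in group_action) orbit_shift:
  assumes "x \<in> E" "g \<in> carrier G"
  shows "orbit G \<phi> (\<phi> g x) = orbit G \<phi> x"
  using assms(2) by (intro orbit_eqI[OF assms(1)]) (auto simp: orbit_def)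

lemma (in group_action) orbit_eq_iff:
  assumes "x \<in> E" "y \<in> E"
  shows "orbit G \<phi> x = orbit G \<phi> y \<longleftrightarrow> (\<exists>g\<in>carrier G. \<phi> g x = y)"
proof -
  have "orbit G \<phi> x = orbit G \<phi> y \<longleftrightarrow> y \<in> orbit G \<phi> x"
    using orbit_eqI[OF assms(1), of y] orbit_refl[OF assms(2)] by metis
  then show ?thesis by (auto simp: orbit_def)
qed

locale coinduced_action =
  fixes G :: "('g, 'r) monoid_scheme" and D :: "('d, 's) monoid_scheme"
    and M :: "'x measure" and M' :: "'y measure"
    and b0 :: "'g \<Rightarrow> 'x \<Rightarrow> 'x" and a0 :: "'d \<Rightarrow> 'x \<Rightarrow> 'x" and a :: "'d \<Rightarrow> 'y \<Rightarrow> 'y"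
    and N :: enat and C :: "nat \<Rightarrow> 'x \<Rightarrow> 'x"
  assumes group_G: "group G" and countable_G: "countable (carrier G)"
    and group_D: "group D" and countable_D: "countable (carrier D)"
    and standard_M: "standard_prob_space M" and prob_M': "prob_space M'"
    and pmp_b0: "pmp_action G M b0" and pmp_a0: "pmp_action D M a0" and pmp_a: "pmp_action D M' a"
    and free_a0: "free_action D M a0"
    and subrelation: "AE x in M. orbit D a0 x \<subseteq> orbit G b0 x"
    and choice: "choice_functions G D M b0 a0 N C"
begin

sublocale G: group G by (rule group_G)
sublocale D: group D by (rule group_D)
sublocale b0: group_action G "space M" b0 using pmp_b0 by (simp add: pmp_action_def)
sublocale a0: group_action D "space M" a0 using pmp_a0 by (simp add: pmp_action_def)
sublocale a: group_action D "space M'" a using pmp_a by (simp add: pmp_action_def)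
sublocale M: prob_space M by (rule standard_prob_space_prob_space[OF standard_M])
sublocale M': prob_space M' by (rule prob_M')

abbreviation "I \<equiv> index_set N"
abbreviation "good \<equiv> good_points G D M b0 a0 N C"
abbreviation "\<kappa> \<equiv> index_perm_inv D b0 a0 N C"
abbreviation "\<delta> \<equiv> delta_cocycle D b0 a0 N C"
abbreviation "Q \<equiv> \<Pi>\<^sub>M n\<in>I. M'"
abbreviation "P \<equiv> coind_space M M' N"
abbreviation "act \<equiv> coind_action G D M b0 a0 N C M' a"

text \<open>
The points at which \<open>\<kappa> g x n = k\<close> and \<open>\<delta> g x n = d\<close>.  Unlike these two definite descriptions, the
sets are visibly measurable; for fixed \<open>g\<close> and \<open>n\<close> they form a countable partition of the good points.
\<close>

definition hit :: "'g \<Rightarrow> nat \<Rightarrow> nat \<Rightarrow> 'd \<Rightarrow> 'x set" where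
  "hit g n k d = {x \<in> good. a0 d (C k x) = C n (b0 g x)}"

lemma C_measurable: "n \<in> I \<Longrightarrow> C n \<in> M \<rightarrow>\<^sub>M M"
  using choice by (simp add: choice_functions_def)

lemma b0_measurable: "g \<in> carrier G \<Longrightarrow> b0 g \<in> M \<rightarrow>\<^sub>M M"
  by (rule pmp_actionD(1)[OF pmp_b0])

lemma a0_measurable: "d \<in> carrier D \<Longrightarrow> a0 d \<in> M \<rightarrow>\<^sub>M M"
  by (rule pmp_actionD(1)[OF pmp_a0])

lemma a_measurable: "d \<in> carrier D \<Longrightarrow> a d \<in> M' \<rightarrow>\<^sub>M M'"
  by (rule pmp_actionD(1)[OF pmp_a])

lemma C_space: "n \<in> I \<Longrightarrow> x \<in> space M \<Longrightarrow> C n x \<in> space M"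
  using measurable_space[OF C_measurable] .

lemma good_space: "x \<in> good \<Longrightarrow> x \<in> space M"
  by (simp add: good_points_def)

lemma good_invariant:
  assumes "x \<in> good" "g \<in> carrier G"
  shows "b0 g x \<in> good"
proof -
  have "orbit G b0 (b0 g x) = orbit G b0 x"
    using b0.orbit_shift[OF good_space[OF assms(1)] assms(2)] .
  moreover have "b0 g x \<in> space M" using b0.element_image assms good_space by blast
  ultimately show ?thesis using assms by (simp add: good_points_def)
qed

lemma good_transversal: "x \<in> good \<Longrightarrow> transversal_at G D b0 a0 N C x"
  using b0.orbit_refl by (auto simp: good_points_def)

lemma good_free:
  assumes "x \<in> good" "n \<in> I" "d \<in> carrier D" "e \<in> carrier D" "a0 d (C n x) = a0 e (C n x)"
  shows "d = e"
proof -
  let ?z = "C n x"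
  have z: "?z \<in> orbit G b0 x" 
    using good_transversal[OF assms(1)] assms(2) by (simp add: transversal_at_def)
  have zs: "?z \<in> space M" using C_space good_space assms by blast
  have "a0 (inv\<^bsub>D\<^esub> e \<otimes>\<^bsub>D\<^esub> d) ?z = a0 (inv\<^bsub>D\<^esub> e) (a0 d ?z)"
    using a0.composition_rule zs assms by simp
  also have "\<dots> = ?z"
    using a0.orbit_sym_aux[OF assms(4) zs] assms(5) by simp
  finally have "inv\<^bsub>D\<^esub> e \<otimes>\<^bsub>D\<^esub> d = \<one>\<^bsub>D\<^esub>"
    using assms(1,3,4) z unfolding good_points_def by blast
  then show ?thesis
    using assms D.inv_equality D.inv_inv D.inv_closed by metis
qed

text \<open>
The point \<open>C n (b0 g x)\<close> lies in the F-class of \<open>x\<close>, so its E-class is represented by one of the \<open>C k x\<close>.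
\<close>

lemma hit_exists:
  assumes "x \<in> good" "g \<in> carrier G" "n \<in> I"
  obtains k d where "k \<in> I" "d \<in> carrier D" "x \<in> hit g n k d"
proof -
  let ?y = "C n (b0 g x)"
  have gx: "b0 g x \<in> good" using good_invariant assms by blast
  have "?y \<in> orbit G b0 (b0 g x)"
    using good_transversal[OF gx] assms(3) by (simp add: transversal_at_def)
  also have "\<dots> = orbit G b0 x"
    using b0.orbit_shift[OF good_space[OF assms(1)] assms(2)] .
  finally obtain k where k: "k \<in> I" "orbit D a0 (C k x) = orbit D a0 ?y"
    using good_transversal[OF assms(1)] unfolding transversal_at_def by blast
  have "C k x \<in> space M" "?y \<in> space M"
    using C_space k assms gx good_space by blast+
  then obtain d where "d \<in> carrier D" "a0 d (C k x) = ?y"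
    using a0.orbit_eq_iff k by blast
  then show ?thesis using that k assms by (auto simp: hit_def)
qed

text \<open>
Transversality at \<open>b0 g x\<close> makes \<open>index_perm\<close> well defined with value \<open>n\<close> at \<open>k\<close>, and transversality
at \<open>x\<close> makes it injective, so that \<open>the_inv_into\<close> recovers \<open>k\<close>; freeness of \<open>a0\<close> on the class makes \<open>d\<close>
unique.  This lemma replaces all further use of the descriptions defining \<open>\<kappa>\<close> and \<open>\<delta>\<close>.
\<close>

lemma hit_unique:
  assumes g: "g \<in> carrier G" and n: "n \<in> I" and k: "k \<in> I" and d: "d \<in> carrier D"
    and x: "x \<in> hit g n k d"
  shows "\<kappa> g x n = k" "\<delta> g x n = d"
proof -
  have xg: "x \<in> good" and eq: "a0 d (C k x) = C n (b0 g x)" using x by (auto simp: hit_def)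
  have gx: "b0 g x \<in> good" using good_invariant xg g by blast
  let ?p = "index_perm D b0 a0 N C g x"
  have sp: "C m x \<in> space M" "C m (b0 g x) \<in> space M" if "m \<in> I" for m
    using that C_space good_space xg gx by auto
  have orb: "orbit G b0 (b0 g x) = orbit G b0 x"
    using b0.orbit_shift[OF good_space[OF xg] g] .
  have Cx: "C m x \<in> orbit G b0 x" if "m \<in> I" for m
    using good_transversal[OF xg] that by (simp add: transversal_at_def)
  have ex1: "\<exists>!m. m \<in> I \<and> orbit D a0 (C k x) = orbit D a0 (C m (b0 g x))" if "k \<in> I" for k
    using good_transversal[OF gx] Cx[OF that] orb unfolding transversal_at_def by metis
  have "orbit D a0 (C k x) = orbit D a0 (C n (b0 g x))"
    using a0.orbit_eq_iff[OF sp(1)[OF k] sp(2)[OF n]] d eq by blast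
  then have pk: "?p k = n"
    unfolding index_perm_def using ex1[OF k] n by (intro the1_equality) auto
  have inj: "inj_on ?p I"
  proof (rule inj_onI)
    fix k1 k2 assume k12: "k1 \<in> I" "k2 \<in> I" "?p k1 = ?p k2"
    have "orbit D a0 (C i x) = orbit D a0 (C (?p i) (b0 g x))" if "i \<in> I" for i
      using theI'[OF ex1[OF that]] unfolding index_perm_def by blast
    then have "orbit D a0 (C k1 x) = orbit D a0 (C k2 x)" using k12 by metis
    then show "k1 = k2"
      using good_transversal[OF xg] Cx k12 unfolding transversal_at_def by metis
  qed
  show kap: "\<kappa> g x n = k"
    unfolding index_perm_inv_def using the_inv_into_f_f[OF inj k] pk by simp
  show "\<delta> g x n = d"
    unfolding delta_cocycle_def kap
  proof (rule the_equality)
    show "d \<in> carrier D \<and> a0 d (C k x) = C n (b0 g x)" using d eq by simp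
    show "e = d" if "e \<in> carrier D \<and> a0 e (C k x) = C n (b0 g x)" for e
      using good_free[OF xg k, of e d] that d eq by simp
  qed
qed

lemma hit_index:
  assumes "x \<in> good" "g \<in> carrier G" "n \<in> I"
  shows "\<kappa> g x n \<in> I" "\<delta> g x n \<in> carrier D" "x \<in> hit g n (\<kappa> g x n) (\<delta> g x n)"
proof -
  obtain k d where "k \<in> I" "d \<in> carrier D" "x \<in> hit g n k d" using hit_exists[OF assms] .
  with hit_unique[OF assms(2,3) this]
  show "\<kappa> g x n \<in> I" "\<delta> g x n \<in> carrier D" "x \<in> hit g n (\<kappa> g x n) (\<delta> g x n)" by auto
qed

text \<open>
Applying the defining equations for \<open>h\<close> at \<open>x\<close> and for \<open>g\<close> at \<open>b0 h x\<close> in succession yields a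
solution of the one for \<open>g \<otimes> h\<close> at \<open>x\<close>, which is unique.
\<close>

lemma cocycle_mult:
  assumes x: "x \<in> good" and g: "g \<in> carrier G" and h: "h \<in> carrier G" and n: "n \<in> I"
  shows "\<kappa> (g \<otimes>\<^bsub>G\<^esub> h) x n = \<kappa> h x (\<kappa> g (b0 h x) n)"
    and "\<delta> (g \<otimes>\<^bsub>G\<^esub> h) x n = \<delta> g (b0 h x) n \<otimes>\<^bsub>D\<^esub> \<delta> h x (\<kappa> g (b0 h x) n)"
proof -
  have hx: "b0 h x \<in> good" using good_invariant x h by blast
  let ?m = "\<kappa> g (b0 h x) n"
  note i1 = hit_index[OF hx g n]
  note i2 = hit_index[OF x h i1(1)]
  have Cs: "C (\<kappa> h x ?m) x \<in> space M" using C_space i2 good_space x by blast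
  have "a0 (\<delta> g (b0 h x) n \<otimes>\<^bsub>D\<^esub> \<delta> h x ?m) (C (\<kappa> h x ?m) x) =
      a0 (\<delta> g (b0 h x) n) (a0 (\<delta> h x ?m) (C (\<kappa> h x ?m) x))"
    by (rule a0.composition_rule[OF Cs i1(2) i2(2)])
  also have "\<dots> = a0 (\<delta> g (b0 h x) n) (C ?m (b0 h x))" using i2(3) by (simp add: hit_def)
  also have "\<dots> = C n (b0 g (b0 h x))" using i1(3) by (simp add: hit_def)
  also have "\<dots> = C n (b0 (g \<otimes>\<^bsub>G\<^esub> h) x)"
    using b0.composition_rule[OF good_space[OF x] g h] by simp
  finally have "x \<in> hit (g \<otimes>\<^bsub>G\<^esub> h) n (\<kappa> h x ?m) (\<delta> g (b0 h x) n \<otimes>\<^bsub>D\<^esub> \<delta> h x ?m)"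
    using x by (simp add: hit_def)
  from hit_unique[OF _ n i2(1) _ this]
  show "\<kappa> (g \<otimes>\<^bsub>G\<^esub> h) x n = \<kappa> h x ?m" "\<delta> (g \<otimes>\<^bsub>G\<^esub> h) x n = \<delta> g (b0 h x) n \<otimes>\<^bsub>D\<^esub> \<delta> h x ?m"
    using g h i1 i2 by auto
qed

lemma b0_one: "x \<in> space M \<Longrightarrow> b0 \<one>\<^bsub>G\<^esub> x = x"
  using b0.id_eq_one by (metis restrict_apply')

lemma a0_one: "x \<in> space M \<Longrightarrow> a0 \<one>\<^bsub>D\<^esub> x = x"
  using a0.id_eq_one by (metis restrict_apply')

lemma a_one: "y \<in> space M' \<Longrightarrow> a \<one>\<^bsub>D\<^esub> y = y"
  using a.id_eq_one by (metis restrict_apply')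

lemma cocycle_one:
  assumes x: "x \<in> good" and n: "n \<in> I"
  shows "\<kappa> \<one>\<^bsub>G\<^esub> x n = n" "\<delta> \<one>\<^bsub>G\<^esub> x n = \<one>\<^bsub>D\<^esub>"
proof -
  have "x \<in> hit \<one>\<^bsub>G\<^esub> n n \<one>\<^bsub>D\<^esub>"
    using x n by (simp add: hit_def b0_one a0_one good_space C_space)
  from hit_unique[OF _ n n _ this]
  show "\<kappa> \<one>\<^bsub>G\<^esub> x n = n" "\<delta> \<one>\<^bsub>G\<^esub> x n = \<one>\<^bsub>D\<^esub>" by auto
qed

lemma index_perm_inv_bij:
  assumes x: "x \<in> good" and g: "g \<in> carrier G"
  shows "bij_betw (\<kappa> g x) I I"
proof (rule bij_betw_byWitness[where f' = "\<kappa> (inv\<^bsub>G\<^esub> g) (b0 g x)"])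
  have i: "inv\<^bsub>G\<^esub> g \<in> carrier G" using g by simp
  have gx: "b0 g x \<in> good" using good_invariant x g by blast
  have undo: "b0 (inv\<^bsub>G\<^esub> g) (b0 g x) = x" using b0.orbit_sym_aux[OF g good_space[OF x]] by simp
  show "\<forall>n\<in>I. \<kappa> (inv\<^bsub>G\<^esub> g) (b0 g x) (\<kappa> g x n) = n"
    using cocycle_mult(1)[OF gx g i] cocycle_one(1)[OF gx] undo g by simp
  show "\<forall>n\<in>I. \<kappa> g x (\<kappa> (inv\<^bsub>G\<^esub> g) (b0 g x) n) = n"
    using cocycle_mult(1)[OF x i g] cocycle_one(1)[OF x] g by simp
  show "\<kappa> g x ` I \<subseteq> I" using hit_index(1)[OF x g] by blast
  show "\<kappa> (inv\<^bsub>G\<^esub> g) (b0 g x) ` I \<subseteq> I" using hit_index(1)[OF gx i] by blast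
qed

section \<open>Measurability\<close>

lemma equality_measurable:
  "f \<in> M \<rightarrow>\<^sub>M M \<Longrightarrow> h \<in> M \<rightarrow>\<^sub>M M \<Longrightarrow> {x \<in> space M. f x = h x} \<in> sets M"
  by (rule standard_prob_space_eq_measurable[OF standard_M])

lemma a0_C_measurable: "k \<in> I \<Longrightarrow> d \<in> carrier D \<Longrightarrow> (\<lambda>x. a0 d (C k x)) \<in> M \<rightarrow>\<^sub>M M"
  using measurable_compose[OF C_measurable a0_measurable] .

lemma C_b0_measurable: "n \<in> I \<Longrightarrow> g \<in> carrier G \<Longrightarrow> (\<lambda>x. C n (b0 g x)) \<in> M \<rightarrow>\<^sub>M M"
  using measurable_compose[OF b0_measurable C_measurable] .

lemma b0_space: "g \<in> carrier G \<Longrightarrow> x \<in> space M \<Longrightarrow> b0 g x \<in> space M"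
  using measurable_space[OF b0_measurable] .

text \<open>
The pointwise conditions behind \<open>good\<close> before they are imposed on the whole F-class.
\<close>

definition regular :: "'x set" where
  "regular = {x \<in> space M. (\<forall>d\<in>carrier D. d \<noteq> \<one>\<^bsub>D\<^esub> \<longrightarrow> a0 d x \<noteq> x) \<and>
     orbit D a0 x \<subseteq> orbit G b0 x \<and> transversal_at G D b0 a0 N C x}"

lemma good_eq_regular: "good = {x \<in> space M. \<forall>g\<in>carrier G. b0 g x \<in> regular}"
  unfolding good_points_def regular_def orbit_def[of G b0] using b0_space by auto

text \<open>
Transversality as a countable Boolean combination of equations between measurable functions of \<open>x\<close>.
\<close>

lemma transversal_at_iff:
  assumes x: "x \<in> space M"
  shows "transversal_at G D b0 a0 N C x \<longleftrightarrow>
     (\<forall>n\<in>I. \<forall>m\<in>I. C n x = C m x \<longrightarrow> n = m) \<and>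
     (\<forall>n\<in>I. \<exists>g\<in>carrier G. C n x = b0 g x) \<and>
     (\<forall>g\<in>carrier G. \<exists>n\<in>I. (\<exists>d\<in>carrier D. a0 d (C n x) = b0 g x) \<and>
        (\<forall>m\<in>I. (\<exists>d\<in>carrier D. a0 d (C m x) = b0 g x) \<longrightarrow> m = n))"
proof -
  have all: "(\<forall>y\<in>orbit G b0 x. R y) \<longleftrightarrow> (\<forall>g\<in>carrier G. R (b0 g x))" for R
    by (auto simp: orbit_def)
  have mem: "y \<in> orbit G b0 x \<longleftrightarrow> (\<exists>g\<in>carrier G. y = b0 g x)" for y
    by (auto simp: orbit_def)
  have classes: "(\<exists>!n. n \<in> I \<and> orbit D a0 (C n x) = orbit D a0 (b0 g x)) \<longleftrightarrow>
     (\<exists>n\<in>I. (\<exists>d\<in>carrier D. a0 d (C n x) = b0 g x) \<and>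
        (\<forall>m\<in>I. (\<exists>d\<in>carrier D. a0 d (C m x) = b0 g x) \<longrightarrow> m = n))" if "g \<in> carrier G" for g
  proof -
    have "orbit D a0 (C n x) = orbit D a0 (b0 g x) \<longleftrightarrow> (\<exists>d\<in>carrier D. a0 d (C n x) = b0 g x)"
      if "n \<in> I" for n
      using a0.orbit_eq_iff C_space[OF that x] b0_space[OF \<open>g \<in> carrier G\<close> x] by blast
    then have iff: "n \<in> I \<and> orbit D a0 (C n x) = orbit D a0 (b0 g x) \<longleftrightarrow>
        n \<in> I \<and> (\<exists>d\<in>carrier D. a0 d (C n x) = b0 g x)" for n
      by blast
    show ?thesis unfolding Ex1_def iff by (simp only: Bex_def Ball_def conj_assoc imp_conjL)
  qed
  show ?thesis
    unfolding transversal_at_def inj_on_def all mem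
    by (rule conj_cong[OF refl conj_cong[OF refl ball_cong[OF refl classes]]])
qed

lemma regular_measurable: "regular \<in> sets M"
proof -
  have "regular = {x \<in> space M. (\<forall>d\<in>carrier D. d \<noteq> \<one>\<^bsub>D\<^esub> \<longrightarrow> \<not> a0 d x = x) \<and>
     (\<forall>d\<in>carrier D. \<exists>g\<in>carrier G. a0 d x = b0 g x) \<and>
     (\<forall>n\<in>I. \<forall>m\<in>I. C n x = C m x \<longrightarrow> n = m) \<and>
     (\<forall>n\<in>I. \<exists>g\<in>carrier G. C n x = b0 g x) \<and>
     (\<forall>g\<in>carrier G. \<exists>n\<in>I. (\<exists>d\<in>carrier D. a0 d (C n x) = b0 g x) \<and>
        (\<forall>m\<in>I. (\<exists>d\<in>carrier D. a0 d (C m x) = b0 g x) \<longrightarrow> m = n))}"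
    unfolding regular_def using transversal_at_iff by (auto simp: orbit_def)
  also have "\<dots> \<in> sets M"
    by (intro sets.sets_Collect_conj sets.sets_Collect_countable_All' sets.sets_Collect_countable_Ex'
        sets.sets_Collect_imp sets.sets_Collect_neg sets.sets_Collect_const countable_G countable_D
        countableI_type equality_measurable a0_C_measurable C_measurable a0_measurable b0_measurable
        measurable_ident_sets refl)
  finally show ?thesis .
qed

lemma good_measurable: "good \<in> sets M"
proof -
  have "{x \<in> space M. b0 g x \<in> regular} \<in> sets M" if "g \<in> carrier G" for g
    using measurable_sets[OF b0_measurable[OF that] regular_measurable]
    by (simp add: vimage_def Int_def conj_commute)
  then show ?thesis
    unfolding good_eq_regular by (intro sets.sets_Collect_countable_All' countable_G)
qed

lemma AE_good: "AE x in M. x \<in> good"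
proof -
  have "AE x in M. \<forall>d\<in>carrier D. d \<noteq> \<one>\<^bsub>D\<^esub> \<longrightarrow> a0 d x \<noteq> x"
    using free_a0 by (auto simp: AE_ball_countable[OF countable_D] free_action_def)
  then have "AE x in M. x \<in> regular"
    using subrelation choice unfolding regular_def choice_functions_def
    by (auto elim!: AE_mp intro!: AE_I2)
  then have "AE x in M. \<forall>g\<in>carrier G. b0 g x \<in> regular"
    unfolding AE_ball_countable[OF countable_G]
    using pmp_actionD(4)[OF pmp_b0, where Q = "\<lambda>x. x \<in> regular"] by blast
  then show ?thesis unfolding good_eq_regular by (auto elim!: AE_mp intro!: AE_I2)
qed

lemma hit_measurable:
  assumes "g \<in> carrier G" "n \<in> I" "k \<in> I" "d \<in> carrier D"
  shows "hit g n k d \<in> sets M"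
proof -
  have "hit g n k d = good \<inter> {x \<in> space M. a0 d (C k x) = C n (b0 g x)}"
    using good_space by (auto simp: hit_def)
  also have "\<dots> \<in> sets M"
    using assms by (intro sets.Int good_measurable equality_measurable a0_C_measurable C_b0_measurable)
  finally show ?thesis .
qed

section \<open>The co-induced formula defines an action\<close>

lemma space_P: "space P = space M \<times> (\<Pi>\<^sub>E n\<in>I. space M')"
  by (simp add: coind_space_def space_pair_measure space_PiM)

lemma act_good:
  assumes "x \<in> good" "y \<in> space Q"
  shows "act g (x, y) = (b0 g x, wreath_map I (\<kappa> g x) (\<lambda>n. a (\<delta> g x n)) y)"
  using assms good_space by (auto simp: coind_action_def space_P space_PiM wreath_map_def)

lemma act_not_good:
  assumes "x \<in> space M" "x \<notin> good" "y \<in> space Q"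
  shows "act g (x, y) = (x, y)"
  using assms by (auto simp: coind_action_def space_P space_PiM)

lemma a_space: "d \<in> carrier D \<Longrightarrow> y \<in> space M' \<Longrightarrow> a d y \<in> space M'"
  using measurable_space[OF a_measurable] .

lemma wreath_map_space:
  assumes "x \<in> good" "g \<in> carrier G" "y \<in> space Q"
  shows "wreath_map I (\<kappa> g x) (\<lambda>n. a (\<delta> g x n)) y \<in> space Q"
  using assms(3) hit_index[OF assms(1,2)] a_space
  by (auto simp: space_PiM wreath_map_def PiE_iff)

lemma act_space:
  assumes "g \<in> carrier G" "p \<in> space P"
  shows "act g p \<in> space P"
proof (cases p)
  case (Pair x y)
  then have xy: "x \<in> space M" "y \<in> space Q" using assms by (auto simp: space_P space_PiM)
  show ?thesis
  proof (cases "x \<in> good")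
    case True
    then show ?thesis
      using act_good[OF True xy(2)] wreath_map_space[OF True assms(1) xy(2)] b0_space[OF assms(1) xy(1)]
      by (simp add: Pair space_P space_PiM)
  next
    case False
    then show ?thesis using act_not_good[OF xy(1) False xy(2)] assms Pair by simp
  qed
qed

text \<open>
On each of the countably many pieces \<open>hit g n k d\<close> the component is \<open>a d\<close> applied to the fixed
coordinate \<open>k\<close>; off the good points it is a coordinate itself.
\<close>

lemma act_component_measurable:
  assumes g: "g \<in> carrier G" and n: "n \<in> I"
  shows "(\<lambda>p. snd (act g p) n) \<in> P \<rightarrow>\<^sub>M M'"
proof (rule measurable_piecewise_restrict)
  let ?piece = "\<lambda>(k, d). hit g n k d \<times> space Q"
  let ?Om = "insert ((space M - good) \<times> space Q) (?piece ` (I \<times> carrier D))"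
  show "countable ?Om" using countable_D by auto
  show "\<Omega> \<inter> space P \<in> sets P" if "\<Omega> \<in> ?Om" for \<Omega>
  proof -
    have "\<Omega> \<in> sets P"
      using that hit_measurable[OF g n] good_measurable unfolding coind_space_def by auto
    then show ?thesis by blast
  qed
  show "space P \<subseteq> \<Union>?Om"
  proof
    fix p assume p: "p \<in> space P"
    obtain x y where xy: "p = (x, y)" "x \<in> space M" "y \<in> space Q"
      using p by (auto simp: space_P space_PiM)
    show "p \<in> \<Union>?Om"
    proof (cases "x \<in> good")
      case True
      obtain k d where "k \<in> I" "d \<in> carrier D" "x \<in> hit g n k d" using hit_exists[OF True g n] .
      then show ?thesis using xy by auto
    qed (use xy in auto)
  qed
  have comp: "(\<lambda>p. snd p k) \<in> P \<rightarrow>\<^sub>M M'" if "k \<in> I" for k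
    unfolding coind_space_def using that by measurable
  show "(\<lambda>p. snd (act g p) n) \<in> restrict_space P \<Omega> \<rightarrow>\<^sub>M M'" if Om: "\<Omega> \<in> ?Om" for \<Omega>
  proof (cases "\<Omega> = (space M - good) \<times> space Q")
    case True
    have "(\<lambda>p. snd p n) \<in> restrict_space P \<Omega> \<rightarrow>\<^sub>M M'"
      by (rule measurable_restrict_space1[OF comp[OF n]])
    moreover have "snd (act g p) n = snd p n" if "p \<in> space (restrict_space P \<Omega>)" for p
      using that act_not_good[of "fst p" "snd p" g] by (auto simp: space_restrict_space True)
    ultimately show ?thesis by (simp cong: measurable_cong)
  next
    case False
    then obtain z where z: "z \<in> I \<times> carrier D" "\<Omega> = ?piece z"
      using Om by blast
    obtain k d where "z = (k, d)" by (cases z)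
    with z have kd: "k \<in> I" "d \<in> carrier D" "\<Omega> = hit g n k d \<times> space Q" by simp_all
    have "(\<lambda>p. a d (snd p k)) \<in> restrict_space P \<Omega> \<rightarrow>\<^sub>M M'"
      by (rule measurable_restrict_space1[OF measurable_compose[OF comp[OF kd(1)] a_measurable[OF kd(2)]]])
    moreover have "snd (act g p) n = a d (snd p k)" if pO: "p \<in> space (restrict_space P \<Omega>)" for p
    proof -
      obtain x y where p: "p = (x, y)" "x \<in> hit g n k d" "y \<in> space Q"
        using pO by (auto simp: space_restrict_space kd(3))
      then have "x \<in> good" by (simp add: hit_def)
      then show ?thesis
        using act_good[OF _ p(3)] hit_unique[OF g n kd(1,2) p(2)] n by (simp add: p(1) wreath_map_def)
    qed
    ultimately show ?thesis by (simp cong: measurable_cong)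
  qed
qed

lemma act_measurable:
  assumes g: "g \<in> carrier G"
  shows "act g \<in> P \<rightarrow>\<^sub>M P"
proof -
  have f: "(\<lambda>p. if fst p \<in> good then b0 g (fst p) else fst p) \<in> P \<rightarrow>\<^sub>M M"
  proof (rule measurable_If)
    have fst: "fst \<in> P \<rightarrow>\<^sub>M M" unfolding coind_space_def by measurable
    then show "fst \<in> P \<rightarrow>\<^sub>M M" .
    show "(\<lambda>p. b0 g (fst p)) \<in> P \<rightarrow>\<^sub>M M" using measurable_compose[OF fst b0_measurable[OF g]] .
    show "{p \<in> space P. fst p \<in> good} \<in> sets P"
      using measurable_sets[OF fst good_measurable] by (simp add: vimage_def Int_def conj_commute)
  qed
  have "(\<lambda>p. fst (act g p)) \<in> P \<rightarrow>\<^sub>M M"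
  proof (rule measurable_cong[THEN iffD1, OF _ f])
    fix p assume "p \<in> space P"
    then show "(if fst p \<in> good then b0 g (fst p) else fst p) = fst (act g p)"
      by (auto simp: coind_action_def split: prod.splits)
  qed
  moreover have "(\<lambda>p. snd (act g p)) \<in> P \<rightarrow>\<^sub>M Q"
  proof (rule measurable_PiM_single')
    show "(\<lambda>p. snd (act g p)) \<in> space P \<rightarrow> (\<Pi>\<^sub>E n\<in>I. space M')"
      using act_space[OF g] by (auto simp: space_P mem_Times_iff)
  qed (rule act_component_measurable[OF g])
  ultimately show ?thesis
    unfolding coind_space_def by (rule measurable_Pair[of "\<lambda>p. fst (act g p)" _ _ "\<lambda>p. snd (act g p)", simplified])
qed

lemma act_mult:
  assumes g: "g \<in> carrier G" and h: "h \<in> carrier G" and p: "p \<in> space P"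
  shows "act (g \<otimes>\<^bsub>G\<^esub> h) p = act g (act h p)"
proof -
  obtain x y where xy: "p = (x, y)" "x \<in> space M" "y \<in> space Q"
    using p by (auto simp: space_P space_PiM)
  show ?thesis
  proof (cases "x \<in> good")
    case False
    then show ?thesis using xy by (simp add: act_not_good)
  next
    case True
    have hx: "b0 h x \<in> good" using good_invariant True h by blast
    let ?y' = "wreath_map I (\<kappa> h x) (\<lambda>n. a (\<delta> h x n)) y"
    have y': "?y' \<in> space Q" by (rule wreath_map_space[OF True h xy(3)])
    have "wreath_map I (\<kappa> (g \<otimes>\<^bsub>G\<^esub> h) x) (\<lambda>n. a (\<delta> (g \<otimes>\<^bsub>G\<^esub> h) x n)) y =
        wreath_map I (\<kappa> g (b0 h x)) (\<lambda>n. a (\<delta> g (b0 h x) n)) ?y'"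
    proof
      fix n
      show "wreath_map I (\<kappa> (g \<otimes>\<^bsub>G\<^esub> h) x) (\<lambda>n. a (\<delta> (g \<otimes>\<^bsub>G\<^esub> h) x n)) y n =
        wreath_map I (\<kappa> g (b0 h x)) (\<lambda>n. a (\<delta> g (b0 h x) n)) ?y' n"
      proof (cases "n \<in> I")
        case n: True
        let ?m = "\<kappa> g (b0 h x) n"
        note i1 = hit_index[OF hx g n]
        note i2 = hit_index[OF True h i1(1)]
        have "y (\<kappa> h x ?m) \<in> space M'" using xy(3) i2(1) by (auto simp: space_PiM)
        then show ?thesis
          using n i1 i2 cocycle_mult[OF True g h n] a.composition_rule by (simp add: wreath_map_def)
      qed (simp add: wreath_map_def)
    qed
    then show ?thesis
      using xy y' hx True by (simp add: act_good b0.composition_rule g h)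
  qed
qed

lemma act_one:
  assumes p: "p \<in> space P"
  shows "act \<one>\<^bsub>G\<^esub> p = p"
proof -
  obtain x y where xy: "p = (x, y)" "x \<in> space M" "y \<in> space Q"
    using p by (auto simp: space_P space_PiM)
  show ?thesis
  proof (cases "x \<in> good")
    case True
    have "wreath_map I (\<kappa> \<one>\<^bsub>G\<^esub> x) (\<lambda>n. a (\<delta> \<one>\<^bsub>G\<^esub> x n)) y = y"
      using xy(3) cocycle_one[OF True]
      by (fastforce simp: wreath_map_def space_PiM PiE_iff extensional_def a_one)
    then show ?thesis using xy True by (simp add: act_good b0_one)
  qed (use xy in \<open>simp add: act_not_good\<close>)
qed

lemma act_group_action: "group_action G (space P) act"
proof -
  have bij: "act g \<in> Bij (space P)" if g: "g \<in> carrier G" for g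
  proof -
    have "bij_betw (act g) (space P) (space P)"
    proof (rule bij_betw_byWitness[where f' = "act (inv\<^bsub>G\<^esub> g)"])
      show "\<forall>p\<in>space P. act (inv\<^bsub>G\<^esub> g) (act g p) = p" "\<forall>p\<in>space P. act g (act (inv\<^bsub>G\<^esub> g) p) = p"
        using g by (simp_all add: act_mult[symmetric] act_one)
    qed (use act_space g in auto)
    moreover have "act g \<in> extensional (space P)"
      by (auto simp: coind_action_def)
    ultimately show ?thesis by (simp add: Bij_def)
  qed
  have "act \<in> hom G (BijGroup (space P))"
  proof (rule homI)
    show "act g \<in> carrier (BijGroup (space P))" if "g \<in> carrier G" for g
      using bij[OF that] by (simp add: BijGroup_def)
    show "act (g \<otimes>\<^bsub>G\<^esub> h) = act g \<otimes>\<^bsub>BijGroup (space P)\<^esub> act h"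
      if "g \<in> carrier G" "h \<in> carrier G" for g h
    proof -
      have "act (g \<otimes>\<^bsub>G\<^esub> h) = compose (space P) (act g) (act h)"
      proof
        fix p show "act (g \<otimes>\<^bsub>G\<^esub> h) p = compose (space P) (act g) (act h) p"
          using act_mult[OF that, of p] by (cases "p \<in> space P") (simp_all add: compose_def coind_action_def)
      qed
      then show ?thesis using bij that by (simp add: BijGroup_def)
    qed
  qed
  then show ?thesis
    unfolding group_action_def by (intro group_hom.intro group_hom_axioms.intro group_G group_BijGroup)
qed

section \<open>Correlations of boxes\<close>

sublocale Q: prob_space Q
  by (rule prob_space_PiM) (rule prob_M')

sublocale MQ: pair_prob_space M Q ..

sublocale P: prob_space P
  unfolding coind_space_def by (rule MQ.P.prob_space_axioms)

lemma box_measurable: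
  assumes "A0 \<in> sets M" "cylinder_family I M' A"
  shows "A0 \<times> Pi\<^sub>E I A \<in> sets P"
  unfolding coind_space_def using assms sets_PiE_cylinder by blast

lemma measure_box:
  assumes "A0 \<in> sets M" "cylinder_family I M' A"
  shows "measure P (A0 \<times> Pi\<^sub>E I A) = measure M A0 * measure Q (Pi\<^sub>E I A)"
  using Q.emeasure_pair_measure_Times[OF assms(1) sets_PiE_cylinder[OF assms(2)]]
  by (simp add: coind_space_def measure_def enn2real_mult)

text \<open>
The slice estimate \<open>wreath_map_correlation\<close> integrated over \<open>x\<close>.  The majorant \<open>u\<close> of the defects is
left open: \<open>u = 0\<close> shows that the action preserves the measure, and a \<open>u\<close> with small integral shows
mixing.
\<close>

lemma box_correlation:
  assumes g: "g \<in> carrier G"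
    and A0: "A0 \<in> sets M" and A: "cylinder_family I M' A" "\<And>i. i \<in> I - K \<Longrightarrow> A i = space M'"
    and B0: "B0 \<in> sets M" and B: "cylinder_family I M' B" "\<And>i. i \<in> I - K \<Longrightarrow> B i = space M'"
    and K: "finite K" "K \<subseteq> I"
    and u: "integrable M u"
    and bound: "\<And>x. x \<in> good \<Longrightarrow>
      (\<Sum>j\<in>K. \<bar>measure M' (A (\<kappa> g x j) \<inter> (a (\<delta> g x j) -` B j \<inter> space M')) -
                 measure M' (A (\<kappa> g x j)) * measure M' (B j)\<bar>) \<le> u x"
  shows "\<bar>measure P ((A0 \<times> Pi\<^sub>E I A) \<inter> (act g -` (B0 \<times> Pi\<^sub>E I B) \<inter> space P)) -
          measure M (A0 \<inter> (b0 g -` B0 \<inter> space M)) * (measure Q (Pi\<^sub>E I A) * measure Q (Pi\<^sub>E I B))\<bar>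
    \<le> (\<integral>x. u x \<partial>M)"
proof -
  let ?X = "(A0 \<times> Pi\<^sub>E I A) \<inter> (act g -` (B0 \<times> Pi\<^sub>E I B) \<inter> space P)"
  let ?S = "A0 \<inter> (b0 g -` B0 \<inter> space M)"
  let ?c = "measure Q (Pi\<^sub>E I A) * measure Q (Pi\<^sub>E I B)"
  have X: "?X \<in> sets (M \<Otimes>\<^sub>M Q)"
    using box_measurable[OF A0 A(1)] measurable_sets[OF act_measurable[OF g] box_measurable[OF B0 B(1)]]
    by (metis coind_space_def sets.Int)
  have S: "?S \<in> sets M" using A0 measurable_sets[OF b0_measurable[OF g] B0] by blast
  note slices = measure_pair_eq_integral_slices[OF M.prob_space_axioms Q.prob_space_axioms X]
  have intS: "integrable M (\<lambda>x. indicator ?S x * ?c)"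
    using S by (simp add: M.emeasure_eq_measure)
  have "AE x in M. \<bar>measure Q (Pair x -` ?X) - indicator ?S x * ?c\<bar> \<le> u x"
    using AE_good
  proof eventually_elim
    case (elim x)
    let ?W = "wreath_map I (\<kappa> g x) (\<lambda>n. a (\<delta> g x n))"
    let ?sum = "\<Sum>j\<in>K. \<bar>measure M' (A (\<kappa> g x j) \<inter> (a (\<delta> g x j) -` B j \<inter> space M')) -
                 measure M' (A (\<kappa> g x j)) * measure M' (B j)\<bar>"
    have AQ: "Pi\<^sub>E I A \<subseteq> space Q" using sets_PiE_cylinder[OF A(1)] sets.sets_into_space by blast
    have slice: "Pair x -` ?X = (if x \<in> ?S then Pi\<^sub>E I A \<inter> {y \<in> space Q. ?W y \<in> Pi\<^sub>E I B} else {})"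
    proof (rule Set.set_eqI)
      fix y
      have "y \<in> Pair x -` ?X \<longleftrightarrow> x \<in> A0 \<and> y \<in> Pi\<^sub>E I A \<and> y \<in> space Q \<and> act g (x, y) \<in> B0 \<times> Pi\<^sub>E I B"
        using good_space[OF elim] AQ by (auto simp: space_P space_PiM)
      also have "\<dots> \<longleftrightarrow> x \<in> A0 \<and> y \<in> Pi\<^sub>E I A \<and> y \<in> space Q \<and> b0 g x \<in> B0 \<and> ?W y \<in> Pi\<^sub>E I B"
        using act_good[OF elim] by auto
      finally show "y \<in> Pair x -` ?X \<longleftrightarrow>
          y \<in> (if x \<in> ?S then Pi\<^sub>E I A \<inter> {y \<in> space Q. ?W y \<in> Pi\<^sub>E I B} else {})"
        using good_space[OF elim] by auto
    qed
    have "\<bar>measure Q (Pair x -` ?X) - indicator ?S x * ?c\<bar> \<le> ?sum"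
    proof (cases "x \<in> ?S")
      case True
      have "\<bar>measure Q (Pi\<^sub>E I A \<inter> {y \<in> space Q. ?W y \<in> Pi\<^sub>E I B}) - ?c\<bar> \<le> ?sum"
      proof (rule wreath_map_correlation[OF prob_M' index_perm_inv_bij[OF elim g] _ _ A B K])
        show "a (\<delta> g x n) \<in> M' \<rightarrow>\<^sub>M M'" if "n \<in> I" for n
          using a_measurable hit_index[OF elim g that] by blast
        show "measure M' (a (\<delta> g x n) -` X \<inter> space M') = measure M' X" if "n \<in> I" "X \<in> sets M'" for n X
          using pmp_actionD(3)[OF pmp_a hit_index(2)[OF elim g that(1)] that(2)] .
      qed
      then show ?thesis unfolding slice using True by simp
    next
      case False
      then show ?thesis unfolding slice by (auto intro!: sum_nonneg)
    qed
    then show ?case using bound[OF elim] by linarith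
  qed
  moreover have "integrable M (\<lambda>x. \<bar>measure Q (Pair x -` ?X) - indicator ?S x * ?c\<bar>)"
    by (intro integrable_abs Bochner_Integration.integrable_diff slices(1) intS)
  ultimately have "(\<integral>x. \<bar>measure Q (Pair x -` ?X) - indicator ?S x * ?c\<bar> \<partial>M) \<le> (\<integral>x. u x \<partial>M)"
    using u by (intro integral_mono_AE)
  moreover have "\<bar>\<integral>x. measure Q (Pair x -` ?X) - indicator ?S x * ?c \<partial>M\<bar> \<le>
      (\<integral>x. \<bar>measure Q (Pair x -` ?X) - indicator ?S x * ?c\<bar> \<partial>M)"
    by (rule integral_abs_bound)
  moreover have "(\<integral>x. measure Q (Pair x -` ?X) - indicator ?S x * ?c \<partial>M) = measure P ?X - measure M ?S * ?c"
  proof -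
    have "(\<integral>x. indicator ?S x * ?c \<partial>M) = measure M ?S * ?c"
      using S by (simp add: M.emeasure_eq_measure)
    moreover have "measure P ?X = (\<integral>x. measure Q (Pair x -` ?X) \<partial>M)"
      using slices(2) by (simp only: coind_space_def)
    ultimately show ?thesis
      by (simp only: Bochner_Integration.integral_diff[OF slices(1) intS])
  qed
  ultimately show ?thesis by linarith
qed

text \<open>
The case of \<open>box_correlation\<close> in which \<open>A\<close> is trivial: each defect vanishes since \<open>a\<close> preserves the
measure.
\<close>

lemma act_preserves_boxes:
  assumes g: "g \<in> carrier G" and B0: "B0 \<in> sets M" and B: "cylinder_family I M' B"
  shows "measure P (act g -` (B0 \<times> Pi\<^sub>E I B) \<inter> space P) = measure P (B0 \<times> Pi\<^sub>E I B)"
proof -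
  let ?Y = "\<lambda>_::nat. space M'"
  define K where "K = {i \<in> I. B i \<noteq> space M'}"
  have K: "finite K" "K \<subseteq> I" "\<And>i. i \<in> I - K \<Longrightarrow> B i = space M'"
    using B by (auto simp: K_def cylinder_family_def)
  have sp: "space P = space M \<times> Pi\<^sub>E I ?Y" "Pi\<^sub>E I ?Y = space Q"
    by (simp_all add: space_P space_PiM)
  have "\<bar>measure P ((space M \<times> Pi\<^sub>E I ?Y) \<inter> (act g -` (B0 \<times> Pi\<^sub>E I B) \<inter> space P)) -
          measure M (space M \<inter> (b0 g -` B0 \<inter> space M)) * (measure Q (Pi\<^sub>E I ?Y) * measure Q (Pi\<^sub>E I B))\<bar>
    \<le> (\<integral>x. 0 \<partial>M)"
  proof (rule box_correlation[OF g sets.top cylinder_family_space _ B0 B K(3) K(1,2)])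
    fix x assume x: "x \<in> good"
    have "measure M' (space M' \<inter> (a (\<delta> g x j) -` B j \<inter> space M')) = measure M' (B j)" if "j \<in> K" for j
    proof -
      have j: "j \<in> I" using that K by auto
      then have "B j \<in> sets M'" using B by (simp add: cylinder_family_def)
      then show ?thesis
        using pmp_actionD(3)[OF pmp_a hit_index(2)[OF x g j]] by (simp add: Int_absorb1 Int_commute)
    qed
    then show "(\<Sum>j\<in>K. \<bar>measure M' (space M' \<inter> (a (\<delta> g x j) -` B j \<inter> space M')) -
                 measure M' (space M') * measure M' (B j)\<bar>) \<le> 0"
      by (simp add: M'.prob_space)
  qed auto
  moreover have "space P \<inter> (act g -` (B0 \<times> Pi\<^sub>E I B) \<inter> space P) = act g -` (B0 \<times> Pi\<^sub>E I B) \<inter> space P"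
    "space M \<inter> (b0 g -` B0 \<inter> space M) = b0 g -` B0 \<inter> space M" by auto
  ultimately show ?thesis
    unfolding sp(1)[symmetric] unfolding sp(2)
    using pmp_actionD(3)[OF pmp_b0 g B0] measure_box[OF B0 B] by (simp add: Q.prob_space)
qed

lemma act_pmp: "pmp_action G P act"
proof -
  have "distr P P (act g) = P" if g: "g \<in> carrier G" for g
  proof (rule measure_eqI_generator_eq_countable)
    note gen = boxes_generate[where M = M and M' = M' and I = I, folded coind_space_def]
    show "Int_stable (boxes M M' I)" "boxes M M' I \<subseteq> Pow (space P)"
      "sets P = sigma_sets (space P) (boxes M M' I)" by (rule gen)+
    then show "sets (distr P P (act g)) = sigma_sets (space P) (boxes M M' I)" by simp
    show "{space P} \<subseteq> boxes M M' I" using gen(4) by simp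
    show "emeasure (distr P P (act g)) X = emeasure P X" if box: "X \<in> boxes M M' I" for X
    proof -
      obtain B0 B where X: "X = B0 \<times> Pi\<^sub>E I B" "B0 \<in> sets M" "cylinder_family I M' B"
        using box unfolding boxes_def by blast
      have "emeasure (distr P P (act g)) X = emeasure P (act g -` X \<inter> space P)"
        using box_measurable X by (intro emeasure_distr act_measurable[OF g]) auto
      then show ?thesis
        using act_preserves_boxes[OF g X(2,3)] by (simp add: P.emeasure_eq_measure X(1))
    qed
    show "emeasure (distr P P (act g)) X \<noteq> \<infinity>" if "X \<in> {space P}" for X
      using that emeasure_distr[OF act_measurable[OF g] sets.top] by (simp add: P.emeasure_eq_measure)
  qed auto
  then show ?thesis
    using act_group_action act_measurable by (simp add: pmp_action_def)
qed

section \<open>Mixing\<close>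

text \<open>
On the conull set where \<open>b0\<close> is free and \<open>b0 g x\<close> lies in a set on which \<open>C n\<close> is injective, the
equation \<open>a0 d (C k x) = C n (b0 g x)\<close> determines first \<open>b0 g x\<close> and then \<open>g\<close>.  So these sets are
essentially disjoint as \<open>g\<close> varies.
\<close>

lemma hit_vanishes:
  assumes free: "free_action G M b0" and n: "n \<in> I" and k: "k \<in> I" and d: "d \<in> carrier D"
  shows "((\<lambda>g. measure M (hit g n k d)) \<longlongrightarrow> 0) (inf cofinite (principal (carrier G)))"
proof -
  obtain Z where Z: "Z \<in> sets M" "AE x in M. x \<in> Z" "inj_on (C n) Z"
    using choice n by (auto simp: choice_functions_def)
  define R where "R = {x \<in> space M. \<forall>g\<in>carrier G. \<forall>h\<in>carrier G. b0 g x = b0 h x \<longrightarrow> g = h}"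
  have R: "R \<in> sets M"
    unfolding R_def
    by (intro sets.sets_Collect_countable_All' sets.sets_Collect_imp sets.sets_Collect_const
        equality_measurable b0_measurable countable_G)
  have "AE x in M. \<forall>g\<in>carrier G. g \<noteq> \<one>\<^bsub>G\<^esub> \<longrightarrow> b0 g x \<noteq> x"
    using free by (auto simp: AE_ball_countable[OF countable_G] free_action_def)
  then have AE_R: "AE x in M. x \<in> R"
    using AE_space
  proof eventually_elim
    case (elim x)
    have "g = h" if gh: "g \<in> carrier G" "h \<in> carrier G" "b0 g x = b0 h x" for g h
    proof -
      have "b0 (inv\<^bsub>G\<^esub> h \<otimes>\<^bsub>G\<^esub> g) x = x"
        using b0.composition_rule[OF elim(2), of "inv\<^bsub>G\<^esub> h" g] b0.orbit_sym_aux[OF gh(2) elim(2)] gh by simp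
      then have "inv\<^bsub>G\<^esub> h \<otimes>\<^bsub>G\<^esub> g = \<one>\<^bsub>G\<^esub>" using elim(1) gh by blast
      then show ?thesis using gh G.inv_equality G.inv_inv G.inv_closed by metis
    qed
    then show ?case using elim(2) by (simp add: R_def)
  qed
  define H where "H g = hit g n k d \<inter> R \<inter> (b0 g -` Z \<inter> space M)" for g
  have H: "H g \<in> sets M" if "g \<in> carrier G" for g
    unfolding H_def using hit_measurable[OF that n k d] R measurable_sets[OF b0_measurable[OF that] Z(1)]
    by blast
  have "disjoint_family_on H (carrier G)"
    unfolding disjoint_family_on_def
  proof (intro ballI impI)
    fix g h assume gh: "g \<in> carrier G" "h \<in> carrier G" "g \<noteq> h"
    show "H g \<inter> H h = {}"
    proof (rule ccontr)
      assume "H g \<inter> H h \<noteq> {}"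
      then obtain x where x: "x \<in> H g" "x \<in> H h" by blast
      then have "C n (b0 g x) = C n (b0 h x)" by (simp add: H_def hit_def)
      then have "b0 g x = b0 h x" using Z(3) x by (auto simp: H_def inj_on_def)
      then show False using x gh by (auto simp: H_def R_def)
    qed
  qed
  then have lim: "((\<lambda>g. measure M (H g)) \<longlongrightarrow> 0) (inf cofinite (principal (carrier G)))"
    using H by (intro disjoint_measure_vanishes M.finite_measure_axioms)
  have same: "measure M (H g) = measure M (hit g n k d)" if g: "g \<in> carrier G" for g
  proof (rule M.finite_measure_eq_AE)
    show "AE x in M. x \<in> H g \<longleftrightarrow> x \<in> hit g n k d"
      using AE_R pmp_actionD(4)[OF pmp_b0 g Z(2)] AE_space by eventually_elim (auto simp: H_def)
  qed (use H g hit_measurable n k d in auto)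
  show ?thesis
    by (rule Lim_transform_eventually[OF lim]) (auto simp: eventually_inf_principal same)
qed

text \<open>
The error is split in three parts, each less than \<open>e / 3\<close>: the defects below the threshold \<open>r\<close>, one
for each of the \<open>card K\<close> indices; the measure of the points with an exceptional \<open>\<delta> g x j\<close>, which
tends to 0 by \<open>hit_vanishes\<close>; and the correlation of \<open>A0\<close> and \<open>B0\<close> under \<open>b0\<close>.
\<close>

lemma box_mixing:
  assumes free: "free_action G M b0" and mix0: "mixing_action G M b0" and mix: "mixing_action D M' a"
    and A0: "A0 \<in> sets M" and A: "cylinder_family I M' A"
    and B0: "B0 \<in> sets M" and B: "cylinder_family I M' B"
  shows "((\<lambda>g. measure P ((A0 \<times> Pi\<^sub>E I A) \<inter> (act g -` (B0 \<times> Pi\<^sub>E I B) \<inter> space P)))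
    \<longlongrightarrow> measure P (A0 \<times> Pi\<^sub>E I A) * measure P (B0 \<times> Pi\<^sub>E I B))
      (inf cofinite (principal (carrier G)))" (is "(?f \<longlongrightarrow> ?l) ?F")
proof (rule tendstoI)
  fix e :: real assume e: "e > 0"
  define K where "K = {i \<in> I. A i \<noteq> space M'} \<union> {i \<in> I. B i \<noteq> space M'}"
  have K: "finite K" "K \<subseteq> I" and KA: "\<And>i. i \<in> I - K \<Longrightarrow> A i = space M'"
    and KB: "\<And>i. i \<in> I - K \<Longrightarrow> B i = space M'"
    using A B by (auto simp: K_def cylinder_family_def)
  \<comment> \<open>The summand 1 keeps the denominator positive when \<open>K\<close> is empty.\<close>
  define r where "r = e / (3 * (card K + 1))"
  have r: "r > 0" "card K * r < e / 3" using e by (auto simp: r_def field_simps)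
  define corr where "corr i j d = \<bar>measure M' (A i \<inter> (a d -` B j \<inter> space M')) -
      measure M' (A i) * measure M' (B j)\<bar>" for i j d
  define bad where "bad i j = {d \<in> carrier D. \<not> corr i j d < r}" for i j
  have AB: "A i \<in> sets M'" "B i \<in> sets M'" if "i \<in> I" for i
    using A B that by (auto simp: cylinder_family_def)
  have bad: "finite (bad i j)" if "i \<in> I" "j \<in> I" for i j
  proof -
    have "((\<lambda>d. measure M' (a d ` A i \<inter> B j)) \<longlongrightarrow> measure M' (A i) * measure M' (B j))
        (inf cofinite (principal (carrier D)))"
      using mix AB that by (simp add: mixing_action_def)
    from tendstoD[OF this r(1)] have "finite {d \<in> carrier D.
        \<not> dist (measure M' (a d ` A i \<inter> B j)) (measure M' (A i) * measure M' (B j)) < r}"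
      by (simp add: eventually_group_infinity)
    also have "{d \<in> carrier D. \<not> dist (measure M' (a d ` A i \<inter> B j)) (measure M' (A i) * measure M' (B j)) < r}
        = bad i j"
      using pmp_action_measure_image_Int[OF pmp_a _ AB(1)[OF that(1)] AB(2)[OF that(2)]]
      by (auto simp: bad_def corr_def dist_real_def)
    finally show ?thesis .
  qed
  \<comment> \<open>Exceptional points are counted with weight 1, which has to dominate the defect there.\<close>
  have corr1: "corr i j d \<le> 1" for i j d
  proof -
    have "0 \<le> measure M' (A i) * measure M' (B j)" "measure M' (A i) * measure M' (B j) \<le> 1"
      by (simp_all add: mult_le_one)
    moreover have "0 \<le> measure M' (A i \<inter> (a d -` B j \<inter> space M'))"
      "measure M' (A i \<inter> (a d -` B j \<inter> space M')) \<le> 1" by simp_all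
    ultimately show ?thesis unfolding corr_def by linarith
  qed
  define u :: "'g \<Rightarrow> 'x \<Rightarrow> real" where
    "u g x = card K * r + (\<Sum>j\<in>K. \<Sum>i\<in>K. \<Sum>d\<in>bad i j. indicator (hit g j i d) x)" for g x
  have hitM: "hit g j i d \<in> sets M" if "g \<in> carrier G" "j \<in> K" "i \<in> K" "d \<in> bad i j" for g i j d
    using that K by (intro hit_measurable) (auto simp: bad_def)
  have u_int: "integrable M (u g)" if "g \<in> carrier G" for g
    unfolding u_def using hitM[OF that] by (auto simp: M.emeasure_eq_measure)
  have u_val: "(\<integral>x. u g x \<partial>M) = card K * r + (\<Sum>j\<in>K. \<Sum>i\<in>K. \<Sum>d\<in>bad i j. measure M (hit g j i d))"
    if "g \<in> carrier G" for g
    unfolding u_def using hitM[OF that]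
    by (subst Bochner_Integration.integral_add)
      (auto simp: M.emeasure_eq_measure M.prob_space Bochner_Integration.integral_sum)
  have u_bound: "(\<Sum>j\<in>K. corr (\<kappa> g x j) j (\<delta> g x j)) \<le> u g x"
    if g: "g \<in> carrier G" and x: "x \<in> good" for g x
  proof -
    have nonneg: "0 \<le> (\<Sum>i\<in>K. \<Sum>d\<in>bad i j. indicator (hit g j i d) x :: real)" for j
      by (intro sum_nonneg) auto
    have "corr (\<kappa> g x j) j (\<delta> g x j) \<le> r + (\<Sum>i\<in>K. \<Sum>d\<in>bad i j. indicator (hit g j i d) x)"
      if j: "j \<in> K" for j
    proof -
      have jI: "j \<in> I" using j K by auto
      let ?i = "\<kappa> g x j" and ?d = "\<delta> g x j"
      note h = hit_index[OF x g jI]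
      show ?thesis
      proof (cases "?i \<in> K \<and> ?d \<in> bad ?i j")
        case True
        have "corr ?i j ?d \<le> indicator (hit g j ?i ?d) x" using corr1 h(3) by simp
        also have "\<dots> \<le> (\<Sum>d\<in>bad ?i j. indicator (hit g j ?i d) x)"
          using True bad[OF h(1) jI] by (intro member_le_sum) auto
        also have "\<dots> \<le> (\<Sum>i\<in>K. \<Sum>d\<in>bad i j. indicator (hit g j i d) x)"
          using True K by (intro member_le_sum sum_nonneg) auto
        finally show ?thesis using r by linarith
      next
        case False
        have "corr ?i j ?d \<le> r"
        proof (cases "?i \<in> K")
          case True
          then show ?thesis using False h(2) by (auto simp: bad_def)
        next
          case False
          \<comment> \<open>A coordinate outside \<open>K\<close> is unconstrained by \<open>A\<close>, so the defect is 0.\<close>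
          then have Ai: "A ?i = space M'" using KA h(1) by simp
          have "measure M' (space M' \<inter> (a ?d -` B j \<inter> space M')) = measure M' (B j)"
            using pmp_actionD(3)[OF pmp_a h(2) AB(2)[OF jI]] by (simp add: Int_absorb1 Int_commute)
          then show ?thesis using r by (simp add: corr_def Ai M'.prob_space)
        qed
        then show ?thesis using nonneg[of j] by linarith
      qed
    qed
    then have "(\<Sum>j\<in>K. corr (\<kappa> g x j) j (\<delta> g x j)) \<le>
        (\<Sum>j\<in>K. r + (\<Sum>i\<in>K. \<Sum>d\<in>bad i j. indicator (hit g j i d) x))"
      by (rule sum_mono)
    then show ?thesis by (simp add: u_def sum.distrib)
  qed
  let ?c = "measure Q (Pi\<^sub>E I A) * measure Q (Pi\<^sub>E I B)"
  let ?m = "\<lambda>g. measure M (A0 \<inter> (b0 g -` B0 \<inter> space M))"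
  have est: "\<bar>?f g - ?m g * ?c\<bar> \<le> card K * r + (\<Sum>j\<in>K. \<Sum>i\<in>K. \<Sum>d\<in>bad i j. measure M (hit g j i d))"
    if g: "g \<in> carrier G" for g
    unfolding u_val[OF g, symmetric]
    by (rule box_correlation[OF g A0 A KA B0 B KB K u_int[OF g]])
      (use u_bound[OF g] in \<open>auto simp: corr_def\<close>)
  have "((\<lambda>g. \<Sum>j\<in>K. \<Sum>i\<in>K. \<Sum>d\<in>bad i j. measure M (hit g j i d)) \<longlongrightarrow>
      (\<Sum>j\<in>K. \<Sum>i\<in>K. \<Sum>d\<in>bad i j. 0)) ?F"
    using K by (intro tendsto_sum hit_vanishes[OF free]) (auto simp: bad_def)
  then have "eventually (\<lambda>g. (\<Sum>j\<in>K. \<Sum>i\<in>K. \<Sum>d\<in>bad i j. measure M (hit g j i d)) < e / 3) ?F"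
    using e by (intro order_tendstoD) auto
  moreover have "eventually (\<lambda>g. \<bar>?m g * ?c - ?l\<bar> < e / 3) ?F"
  proof -
    have "((\<lambda>g. measure M (b0 g ` A0 \<inter> B0)) \<longlongrightarrow> measure M A0 * measure M B0) ?F"
      using mix0 A0 B0 by (simp add: mixing_action_def)
    then have "(?m \<longlongrightarrow> measure M A0 * measure M B0) ?F"
      by (rule Lim_transform_eventually)
        (auto simp: eventually_inf_principal pmp_action_measure_image_Int[OF pmp_b0 _ A0 B0])
    then have "((\<lambda>g. ?m g * ?c) \<longlongrightarrow> measure M A0 * measure M B0 * ?c) ?F"
      by (intro tendsto_intros)
    moreover have "measure M A0 * measure M B0 * ?c = ?l"
      by (simp add: measure_box A0 A B0 B)
    ultimately have "((\<lambda>g. ?m g * ?c) \<longlongrightarrow> ?l) ?F" by simp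
    from tendstoD[OF this, of "e / 3"] show ?thesis using e by (simp add: dist_real_def)
  qed
  moreover have "eventually (\<lambda>g. g \<in> carrier G) ?F" by (simp add: eventually_inf_principal)
  ultimately show "eventually (\<lambda>g. dist (?f g) ?l < e) ?F"
  proof eventually_elim
    case (elim g)
    then show ?case using est[OF elim(3)] r(2) unfolding dist_real_def by linarith
  qed
qed

theorem act_mixing:
  assumes "free_action G M b0" and "mixing_action G M b0" and "mixing_action D M' a"
  shows "mixing_action G P act"
proof (rule mixing_action_from_generator[OF P.prob_space_axioms act_pmp])
  note gen = boxes_generate[where M = M and M' = M' and I = I, folded coind_space_def]
  show "Int_stable (boxes M M' I)" "boxes M M' I \<subseteq> Pow (space P)"
    "sets P = sigma_sets (space P) (boxes M M' I)" "space P \<in> boxes M M' I" by (rule gen)+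
  fix X Y assume "X \<in> boxes M M' I" "Y \<in> boxes M M' I"
  then show "((\<lambda>g. measure P (X \<inter> (act g -` Y \<inter> space P))) \<longlongrightarrow> measure P X * measure P Y)
      (inf cofinite (principal (carrier G)))"
    unfolding boxes_def using box_mixing[OF assms] by blast
qed

end

theorem proposition3p1:
  fixes G :: "('g, 'r) monoid_scheme" and D :: "('d, 's) monoid_scheme"
    and M :: "'x measure" and M' :: "'y measure"
    and b0 :: "'g \<Rightarrow> 'x \<Rightarrow> 'x" and a0 :: "'d \<Rightarrow> 'x \<Rightarrow> 'x" and a :: "'d \<Rightarrow> 'y \<Rightarrow> 'y"
    and N :: enat and C :: "nat \<Rightarrow> 'x \<Rightarrow> 'x"
  assumes "group G" and "countable (carrier G)"
    and "group D" and "countable (carrier D)"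
    and "standard_prob_space M"
    and "pmp_action G M b0"
    and "pmp_action D M a0" and "free_action D M a0"
    and "AE x in M. orbit D a0 x \<subseteq> orbit G b0 x"
    and "N \<ge> 1"
    and "AE x in M. eqpoll (orbit D a0 ` orbit G b0 x) (index_set N)"
    and "free_action G M b0" and "mixing_action G M b0"
    and "ergodic_action D M a0"
    and "choice_functions G D M b0 a0 N C"
    and "standard_prob_space M'"
    and "pmp_action D M' a"
    and "mixing_action D M' a"
  shows "mixing_action G (coind_space M M' N) (coind_action G D M b0 a0 N C M' a)"
proof -
  interpret coinduced_action G D M M' b0 a0 a N C
    by (rule coinduced_action.intro) (fact assms standard_prob_space_prob_space[OF assms(16)])+
  show ?thesis by (rule act_mixing) (fact assms)+
qed

end
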